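(* Let $N\ge1$, $0<s<1$, $1<p<\infty$ with $s\,p>N$, and let $x_0,y_0\in\mathbb{R}^N$ be two distinct points. For $u:\mathbb{R}^N\to\mathbb{R}$ the following are equivalent: (i) $u\in\mathcal{W}^{s,p}(\mathbb{R}^N)$ is an extremal for $\mathfrak{m}_{s,p}(\mathbb{R}^N)$ and $[u]_{C^{0,\alpha_{s,p}}(\mathbb{R}^N)}=\frac{|u(x_0)-u(y_0)|}{|x_0-y_0|^{\alpha_{s,p}}}$; (ii) $u\in \mathcal{W}^{s,p}(\mathbb{R}^N)$ weakly solves $(-\Delta_p)^s u=c\,(\delta_{x_0}-\delta_{y_0})$ in $\mathbb{R}^N$ for some constant $c\neq0$, i.e. \[ \iint_{\mathbb{R}^N\times\mathbb{R}^N} \frac{J_p(u(x)-u(y))\,(\varphi(x)-\varphi(y))}{|x-y|^{N+s\,p}}\,dx\,dy=c\,(\varphi(x_0)-\varphi(y_0))\quad\text{for every }\varphi\in\mathcal{W}^{s,p}(\mathbb{R}^N); \] (iii) $u\in\mathcal{W}^{s,p}(\mathbb{R}^N)$ is non-constant and is the unique minimizer of \[ \inf_{\varphi\in \mathcal{W}^{s,p}(\mathbb{R}^N)}\Big\{[\varphi]^p_{W^{s,p}(\mathbb{R}^N)}\, :\, \varphi(x_0)=u(x_0)\, \mbox{ and } \varphi(y_0)=u(y_0)\Big\}. \]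
   Context: $J_p(t)=|t|^{p-2}t$. $[\varphi]_{W^{s,p}(\mathbb{R}^N)}=\left(\iint_{\mathbb{R}^N\times\mathbb{R}^N}\frac{|\varphi(x)-\varphi(y)|^p}{|x-y|^{N+s\,p}}dx\,dy\right)^{1/p}$; $[\varphi]_{C^{0,\alpha}(\mathbb{R}^N)}=\sup_{x\ne y}\frac{|\varphi(x)-\varphi(y)|}{|x-y|^\alpha}$; $\alpha_{s,p}=s-N/p$. $\mathcal{W}^{s,p}(\mathbb{R}^N)$ is the set of continuous functions with finite $[\cdot]_{C^{0,\alpha_{s,p}}(\mathbb{R}^N)}$ and finite $[\cdot]_{W^{s,p}(\mathbb{R}^N)}$. $\mathfrak{m}_{s,p}(\mathbb{R}^N)=\inf\{[\varphi]^p_{W^{s,p}(\mathbb{R}^N)}:\varphi\in C^\infty_0(\mathbb{R}^N),\ [\varphi]_{C^{0,\alpha_{s,p}}(\mathbb{R}^N)}=1\}$. An extremal is a non-constant $u\in\mathcal{W}^{s,p}(\mathbb{R}^N)$ with $[u]^p_{W^{s,p}(\mathbb{R}^N)}=\mathfrak{m}_{s,p}(\mathbb{R}^N)[u]^p_{C^{0,\alpha_{s,p}}(\mathbb{R}^N)}$. *)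

theory Defs
  imports "HOL-Analysis.Analysis"
begin

text \<open>Setting: \<open>\<real>^N\<close> is rendered as an arbitrary Euclidean space \<open>'a\<close>, with \<open>N = DIM('a)\<close>.\<close>

definition Jp :: "real \<Rightarrow> real \<Rightarrow> real" where
  "Jp p t = \<bar>t\<bar> powr (p - 2) * t"

definition alpha_sp :: "real \<Rightarrow> real \<Rightarrow> nat \<Rightarrow> real" where
  "alpha_sp s p N = s - real N / p"

definition gagliardo_enn :: "real \<Rightarrow> real \<Rightarrow> ('a::euclidean_space \<Rightarrow> real) \<Rightarrow> ennreal" where
  "gagliardo_enn s p \<phi> =
     (\<integral>\<^sup>+ z. ennreal (\<bar>\<phi> (fst z) - \<phi> (snd z)\<bar> powr p
        / norm (fst z - snd z) powr (real DIM('a) + s * p)) \<partial>(lborel \<Otimes>\<^sub>M lborel))"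

text \<open>\<open>[\<phi>]^p_{W^{s,p}}\<close> (meaningful when finite).\<close>
definition gagliardo_p :: "real \<Rightarrow> real \<Rightarrow> ('a::euclidean_space \<Rightarrow> real) \<Rightarrow> real" where
  "gagliardo_p s p \<phi> = enn2real (gagliardo_enn s p \<phi>)"

definition holder_bounded :: "real \<Rightarrow> ('a::euclidean_space \<Rightarrow> real) \<Rightarrow> bool" where
  "holder_bounded \<alpha> \<phi> \<longleftrightarrow> (\<exists>C. \<forall>x y. x \<noteq> y \<longrightarrow> \<bar>\<phi> x - \<phi> y\<bar> / norm (x - y) powr \<alpha> \<le> C)"

text \<open>\<open>[\<phi>]_{C^{0,\<alpha>}}\<close> (meaningful when \<open>holder_bounded \<alpha> \<phi>\<close>).\<close>
definition holder_sn :: "real \<Rightarrow> ('a::euclidean_space \<Rightarrow> real) \<Rightarrow> real" where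
  "holder_sn \<alpha> \<phi> = (SUP z\<in>{z. fst z \<noteq> snd z}.
      \<bar>\<phi> (fst z) - \<phi> (snd z)\<bar> / norm (fst z - snd z) powr \<alpha>)"

definition Wsp :: "real \<Rightarrow> real \<Rightarrow> ('a::euclidean_space \<Rightarrow> real) set" where
  "Wsp s p = {\<phi>. continuous_on UNIV \<phi>
                  \<and> holder_bounded (alpha_sp s p DIM('a)) \<phi>
                  \<and> gagliardo_enn s p \<phi> < \<infinity>}"

definition partial_deriv :: "'a::euclidean_space \<Rightarrow> ('a \<Rightarrow> real) \<Rightarrow> 'a \<Rightarrow> real" where
  "partial_deriv v f x = deriv (\<lambda>t. f (x + t *\<^sub>R v)) 0"

definition smooth_fun :: "('a::euclidean_space \<Rightarrow> real) \<Rightarrow> bool" where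
  "smooth_fun f \<longleftrightarrow> (\<forall>vs. set vs \<subseteq> Basis \<longrightarrow>
      continuous_on UNIV (foldr partial_deriv vs f) \<and>
      (\<forall>v\<in>Basis. \<forall>x. (\<lambda>t. foldr partial_deriv vs f (x + t *\<^sub>R v)) differentiable (at 0)))"

definition test_fun :: "('a::euclidean_space \<Rightarrow> real) \<Rightarrow> bool" where
  "test_fun f \<longleftrightarrow> smooth_fun f \<and> compact (closure {x. f x \<noteq> 0})"

definition m_sp :: "real \<Rightarrow> real \<Rightarrow> 'a::euclidean_space itself \<Rightarrow> real" where
  "m_sp s p _ = Inf {gagliardo_p s p \<phi> | \<phi> :: 'a \<Rightarrow> real.
      test_fun \<phi> \<and> holder_sn (alpha_sp s p DIM('a)) \<phi> = 1}"

definition extremal :: "real \<Rightarrow> real \<Rightarrow> ('a::euclidean_space \<Rightarrow> real) \<Rightarrow> bool" where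
  "extremal s p u \<longleftrightarrow> u \<in> Wsp s p \<and> (\<exists>x y. u x \<noteq> u y) \<and>
     gagliardo_p s p u = m_sp s p TYPE('a) * holder_sn (alpha_sp s p DIM('a)) u powr p"

definition weak_dipole_solution ::
  "real \<Rightarrow> real \<Rightarrow> ('a::euclidean_space \<Rightarrow> real) \<Rightarrow> real \<Rightarrow> 'a \<Rightarrow> 'a \<Rightarrow> bool" where
  "weak_dipole_solution s p u c x0 y0 \<longleftrightarrow> (\<forall>\<phi>\<in>Wsp s p.
     (\<integral>z. Jp p (u (fst z) - u (snd z)) * (\<phi> (fst z) - \<phi> (snd z))
          / norm (fst z - snd z) powr (real DIM('a) + s * p) \<partial>(lborel \<Otimes>\<^sub>M lborel))
     = c * (\<phi> x0 - \<phi> y0))"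

end

theory Submission
  imports Defs "HOL-Computational_Algebra.Polynomial"
begin

text \<open>
  Write \<open>E\<close> for the energy \<open>[\<cdot>]^p\<close>, \<open>\<alpha> = s - N/p\<close> and \<open>m\<close> for the Morrey constant. Strict convexity of
  \<open>E\<close> makes the dipole equation equivalent to unique minimality under prescribed values at \<open>x0\<close> and
  \<open>y0\<close>: the equation is the statement that the derivative of \<open>E\<close> at \<open>u\<close> annihilates all functions
  vanishing at both points.

  By density, the inequality \<open>m \<bar>f x - f y\<bar>^p \<le> \<bar>x - y\<bar>^(\<alpha> p) E f\<close> passes from test functions to every
  \<open>f\<close>: since \<open>s p > N\<close>, the energy of a dilated cut-off tends to zero, so a bounded function can be cut
  off at arbitrarily small cost, and mollification does not increase \<open>E\<close>. Hence an extremal whose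
  Hoelder quotient is attained at \<open>(x0, y0)\<close> is a two-point minimizer. Conversely, \<open>E\<close> scales by \<open>r^(s p - N)\<close>
  under similarities of ratio \<open>r\<close>, and these act transitively on pairs of distinct points. So the
  energy of a two-point minimizer bounds the quotient of every function at every pair, which identifies
  the Hoelder seminorm of \<open>u\<close> and shows that \<open>u\<close> attains \<open>m\<close>.
\<close>

section \<open>Convexity of the power function\<close>

text \<open>The difficulty is that \<open>m_sp\<close> is an infimum over test functions alone,
  while competitors range over all of \<open>Wsp\<close>, and no constant may be lost on the way:
  with a factor below one in front of \<open>m_sp\<close>, the minimality of an extremal would not
  follow. This selects the approximations. The cut-off is a minimum with a dilated plateau function
  rather than a product, because an increment of a minimum is at most the larger of the two
  increments; so the energies add, with coefficient one on the energy of \<open>f\<close>. Smoothing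
  averages translates, where Jensen's inequality has constant one. In both limits it is enough to
  follow the values at the two given points, the energies being only bounded from above.

  Test functions are defined through iterated partial derivatives, so the mollifier is a product of
  one-variable bumps: its partial derivatives stay within an explicit class, on which a single
  induction proves smoothness. The reverse bound on \<open>m_sp\<close> involves no approximation:
  an affine change of values and a similarity turn each admissible test function into a
  competitor.\<close>

lemma Jp_eq_max:
  assumes "1 < p" shows "Jp p t = max t 0 powr (p - 1) - max (- t) 0 powr (p - 1)"
proof (cases t "0::real" rule: linorder_cases)
  case less
  have "\<bar>t\<bar> powr (p - 2) * \<bar>t\<bar> = \<bar>t\<bar> powr (p - 1)"
    using less powr_add[of "\<bar>t\<bar>" "p - 2" 1] by simp
  then show ?thesis using less assms by (simp add: Jp_def)
next
  case equal then show ?thesis using assms by (simp add: Jp_def)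
next
  case greater
  have "\<bar>t\<bar> powr (p - 2) * \<bar>t\<bar> = \<bar>t\<bar> powr (p - 1)"
    using greater powr_add[of "\<bar>t\<bar>" "p - 2" 1] by simp
  then show ?thesis using greater assms by (simp add: Jp_def)
qed

text \<open>The factor \<open>\<bar>t\<bar> powr (p - 2)\<close> of the definition is unbounded near
  zero when p < 2; in the form with two truncated powers the exponent p - 1 is positive and each
  summand is continuous.\<close>

lemma continuous_on_Jp:
  assumes "1 < p" shows "continuous_on UNIV (Jp p)"
proof -
  have "continuous_on UNIV (\<lambda>t. max t 0 powr (p - 1) - max (- t) 0 powr (p - 1))"
    using assms by (intro continuous_intros continuous_on_powr') auto
  then show ?thesis by (simp add: Jp_eq_max[OF assms] cong: continuous_on_cong)
qed

lemma abs_Jp: assumes "1 < p" shows "\<bar>Jp p t\<bar> = \<bar>t\<bar> powr (p - 1)"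
  using assms by (auto simp: Jp_eq_max max_def)

lemma Jp_mult_self: assumes "1 < p" shows "Jp p t * t = \<bar>t\<bar> powr p"
proof (cases "t = 0")
  case False
  have "\<bar>t\<bar> powr p = \<bar>t\<bar> powr (p - 2) * \<bar>t\<bar> powr 2"
    using powr_add[of "\<bar>t\<bar>" "p - 2" 2] by simp
  then show ?thesis using False by (simp add: Jp_def power2_eq_square)
qed (use assms in \<open>simp add: Jp_def\<close>)

text \<open>From x to y neither truncated power moves in the wrong direction; the positive one moves
  strictly if y > 0, the negative one otherwise.\<close>

lemma Jp_strict_mono:
  assumes "1 < p" "x < y" shows "Jp p x < Jp p y"
proof -
  have m: "a powr (p - 1) < b powr (p - 1)" if "0 \<le> a" "a < b" for a b :: real
    using that assms(1) by (intro powr_less_mono2) auto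
  have n: "a powr (p - 1) \<le> b powr (p - 1)" if "0 \<le> a" "a \<le> b" for a b :: real
    using that assms(1) by (intro powr_mono2) auto
  show ?thesis
  proof (cases "y > 0")
    case True
    have "max x 0 powr (p - 1) < max y 0 powr (p - 1)"
      using True assms by (intro m) auto
    moreover have "max (- y) 0 powr (p - 1) \<le> max (- x) 0 powr (p - 1)"
      using assms by (intro n) auto
    ultimately show ?thesis by (simp add: Jp_eq_max[OF assms(1)])
  next
    case False
    have "max (- y) 0 powr (p - 1) < max (- x) 0 powr (p - 1)"
      using False assms by (intro m) auto
    moreover have "max x 0 powr (p - 1) \<le> max y 0 powr (p - 1)"
      using assms by (intro n) auto
    ultimately show ?thesis by (simp add: Jp_eq_max[OF assms(1)])
  qed
qed

lemma has_real_derivative_abs_powr: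
  assumes "1 < p" shows "((\<lambda>t. \<bar>t\<bar> powr p) has_real_derivative p * Jp p t) (at t)"
proof (cases t "0::real" rule: linorder_cases)
  case less
  have "((\<lambda>t. (- t) powr p) has_real_derivative p * Jp p t) (at t)"
    using less assms by (auto intro!: derivative_eq_intros simp: Jp_eq_max max_def powr_diff)
  then show ?thesis
    by (rule DERIV_cong_ev[THEN iffD1, rotated -1])
       (use less eventually_nhds_in_open[of "{..<0}" t] in \<open>auto elim!: eventually_mono\<close>)
next
  case greater
  have "((\<lambda>t. t powr p) has_real_derivative p * Jp p t) (at t)"
    using greater assms by (auto intro!: derivative_eq_intros simp: Jp_eq_max max_def powr_diff)
  then show ?thesis
    by (rule DERIV_cong_ev[THEN iffD1, rotated -1])
       (use greater eventually_nhds_in_open[of "{0<..}" t] in \<open>auto elim!: eventually_mono\<close>)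
next
  case equal
  \<comment> \<open>At zero the difference quotient |h|^p / h is J_p(h) itself, so differentiability
    there is the continuity of J_p.\<close>
  have "(Jp p \<longlongrightarrow> Jp p 0) (at 0)"
    using continuous_on_Jp[OF assms] by (simp add: continuous_on_eq_continuous_at isCont_def)
  then have "(Jp p \<longlongrightarrow> 0) (at 0)" by (simp add: Jp_def)
  then have "((\<lambda>h. \<bar>h\<bar> powr p / h) \<longlongrightarrow> 0) (at 0)"
    by (rule Lim_transform_eventually)
       (auto simp: eventually_at_filter Jp_mult_self[OF assms, symmetric] Jp_def)
  then show ?thesis using assms equal by (simp add: DERIV_def Jp_def)
qed

text \<open>Strict convexity in tangent form: the mean value theorem turns the gap into a difference
  of values of J_p, whose sign is given by strict monotonicity. The strict version later yields
  uniqueness, the weak one minimality.\<close>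

lemma abs_powr_strict_subgradient:
  assumes "1 < p" "a \<noteq> b"
  shows "\<bar>b\<bar> powr p + p * Jp p b * (a - b) < \<bar>a\<bar> powr p"
proof (cases "b < a")
  case True
  then obtain z where z: "b < z" "z < a" "\<bar>a\<bar> powr p - \<bar>b\<bar> powr p = (a - b) * (p * Jp p z)"
    using MVT2[of b a "\<lambda>t. \<bar>t\<bar> powr p" "\<lambda>t. p * Jp p t"] has_real_derivative_abs_powr[OF assms(1)]
    by blast
  have "(a - b) * (p * Jp p b) < (a - b) * (p * Jp p z)"
    using Jp_strict_mono[OF assms(1) z(1)] True assms by simp
  then show ?thesis using z(3) by (simp add: algebra_simps)
next
  case False
  then have ab: "a < b" using assms by simp
  then obtain z where z: "a < z" "z < b" "\<bar>b\<bar> powr p - \<bar>a\<bar> powr p = (b - a) * (p * Jp p z)"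
    using MVT2[of a b "\<lambda>t. \<bar>t\<bar> powr p" "\<lambda>t. p * Jp p t"] has_real_derivative_abs_powr[OF assms(1)]
    by blast
  have "(b - a) * (p * Jp p z) < (b - a) * (p * Jp p b)"
    using Jp_strict_mono[OF assms(1) z(2)] ab assms by simp
  then show ?thesis using z(3) by (simp add: algebra_simps)
qed

lemma abs_powr_subgradient:
  assumes "1 < p"
  shows "\<bar>b\<bar> powr p + p * Jp p b * (a - b) \<le> \<bar>a\<bar> powr p"
  using abs_powr_strict_subgradient[OF assms, of a b] by (cases "a = b") auto

text \<open>Estimating a maximum instead of a sum keeps coefficient one on both terms, which is what
  the cut-off argument requires.\<close>

lemma max_powr_le_sum:
  fixes a b :: real assumes "0 \<le> a" "0 \<le> b"
  shows "max a b powr p \<le> a powr p + b powr p"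
  using assms by (auto simp: max_def)

lemma abs_add_powr_le:
  fixes a b p :: real
  assumes "1 < p" shows "\<bar>a + b\<bar> powr p \<le> 2 powr p * (\<bar>a\<bar> powr p + \<bar>b\<bar> powr p)"
proof -
  have "\<bar>a + b\<bar> powr p \<le> (2 * max \<bar>a\<bar> \<bar>b\<bar>) powr p"
    using assms by (intro powr_mono2) auto
  also have "\<dots> = 2 powr p * max \<bar>a\<bar> \<bar>b\<bar> powr p" by (simp add: powr_mult)
  also have "\<dots> \<le> 2 powr p * (\<bar>a\<bar> powr p + \<bar>b\<bar> powr p)"
    by (intro mult_left_mono max_powr_le_sum) auto
  finally show ?thesis .
qed

text \<open>A majorant, uniform in |t| <= 1, for the first variation along u + t f. It serves
  dominated convergence as t tends to 0, and at t = 0 the integrability of the pairing.\<close>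

lemma abs_Jp_add_mult_le:
  assumes "1 < p" "\<bar>t\<bar> \<le> 1"
  shows "\<bar>Jp p (a + t * b) * b\<bar> \<le> 2 powr p * (\<bar>a\<bar> powr p + \<bar>b\<bar> powr p)"
proof -
  \<comment> \<open>One number dominates both |a + t b| and |b|, so the product of powers collapses
    to m^p.\<close>
  define m where "m = 2 * max \<bar>a\<bar> \<bar>b\<bar>"
  have "\<bar>t * b\<bar> \<le> \<bar>b\<bar>" using assms mult_right_mono[of "\<bar>t\<bar>" 1 "\<bar>b\<bar>"] by (simp add: abs_mult)
  then have "\<bar>a + t * b\<bar> \<le> m" "\<bar>b\<bar> \<le> m" "0 \<le> m" unfolding m_def by auto
  then have "\<bar>a + t * b\<bar> powr (p - 1) * \<bar>b\<bar> \<le> m powr (p - 1) * m powr 1"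
    using assms by (intro mult_mono powr_mono2) auto
  also have "\<dots> = m powr p" 
    using powr_add[of m "p - 1" 1] by simp
  also have "\<dots> = 2 powr p * max \<bar>a\<bar> \<bar>b\<bar> powr p" by (simp add: powr_mult m_def)
  also have "\<dots> \<le> 2 powr p * (\<bar>a\<bar> powr p + \<bar>b\<bar> powr p)"
    by (intro mult_left_mono max_powr_le_sum) auto
  finally show ?thesis by (simp add: abs_mult abs_Jp[OF assms(1)])
qed

section \<open>The energy, its derivative and minimizers\<close>

text \<open>On the diagonal the quotient is 0 / 0 = 0, so no points have to be excluded from the
  integrals.\<close>

definition gdens :: "real \<Rightarrow> real \<Rightarrow> ('a::euclidean_space \<Rightarrow> real) \<Rightarrow> 'a \<times> 'a \<Rightarrow> real" where
  "gdens s p f z = \<bar>f (fst z) - f (snd z)\<bar> powr p / norm (fst z - snd z) powr (real DIM('a) + s * p)"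

lemma gdens_nonneg [simp]: "0 \<le> gdens s p f z"
  by (simp add: gdens_def)

lemma gagliardo_enn_gdens:
  "gagliardo_enn s p f = (\<integral>\<^sup>+ z. ennreal (gdens s p f z) \<partial>(lborel \<Otimes>\<^sub>M lborel))"
  unfolding gagliardo_enn_def gdens_def ..

lemma borel_measurable_gdens [measurable]:
  fixes f :: "'a::euclidean_space \<Rightarrow> real"
  assumes [measurable]: "f \<in> borel_measurable borel"
  shows "gdens s p f \<in> borel_measurable (lborel \<Otimes>\<^sub>M lborel)"
  unfolding gdens_def by measurable

lemma Wsp_measurable: "f \<in> Wsp s p \<Longrightarrow> f \<in> borel_measurable borel"
  by (simp add: Wsp_def borel_measurable_continuous_onI)

lemma Wsp_integrable:
  assumes "f \<in> Wsp s p"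
  shows "integrable (lborel \<Otimes>\<^sub>M lborel) (gdens s p f)"
proof -
  have [measurable]: "f \<in> borel_measurable borel" using assms by (rule Wsp_measurable)
  show ?thesis
    using assms by (intro integrableI_nonneg) (auto simp: Wsp_def gagliardo_enn_gdens)
qed

lemma gagliardo_p_integral:
  assumes "f \<in> Wsp s p"
  shows "gagliardo_p s p f = (\<integral>z. gdens s p f z \<partial>(lborel \<Otimes>\<^sub>M lborel))"
proof -
  have [measurable]: "f \<in> borel_measurable borel" using assms by (rule Wsp_measurable)
  show ?thesis
    unfolding gagliardo_p_def gagliardo_enn_gdens by (subst integral_eq_nn_integral) auto
qed

lemma gagliardo_enn_eq_ennreal:
  "f \<in> Wsp s p \<Longrightarrow> gagliardo_enn s p f = ennreal (gagliardo_p s p f)"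
  by (simp add: gagliardo_p_def Wsp_def)

lemma gagliardo_p_nonneg [simp]: "0 \<le> gagliardo_p s p f"
  by (simp add: gagliardo_p_def)

lemma holder_boundedI:
  assumes "\<And>x y. \<bar>f x - f y\<bar> \<le> C * norm (x - y) powr \<alpha>"
  shows "holder_bounded \<alpha> f"
  unfolding holder_bounded_def using assms by (intro exI[of _ C]) (auto simp: divide_simps)

lemma holder_boundedE:
  assumes "holder_bounded \<alpha> f"
  obtains C where "0 \<le> C" "\<And>x y. \<bar>f x - f y\<bar> \<le> C * norm (x - y) powr \<alpha>"
proof -
  obtain C where C: "\<And>x y. x \<noteq> y \<Longrightarrow> \<bar>f x - f y\<bar> / norm (x - y) powr \<alpha> \<le> C"
    using assms unfolding holder_bounded_def by blast
  have "\<bar>f x - f y\<bar> \<le> max C 0 * norm (x - y) powr \<alpha>" for x y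
  proof (cases "x = y")
    case False
    then have "\<bar>f x - f y\<bar> \<le> C * norm (x - y) powr \<alpha>"
      using C[OF False] by (simp add: divide_simps)
    also have "\<dots> \<le> max C 0 * norm (x - y) powr \<alpha>" by (intro mult_right_mono) auto
    finally show ?thesis .
  qed simp
  then show ?thesis using that[of "max C 0"] by simp
qed

lemma WspD:
  fixes f :: "'a::euclidean_space \<Rightarrow> real"
  assumes "f \<in> Wsp s p"
  shows "continuous_on UNIV f" "holder_bounded (alpha_sp s p DIM('a)) f" "gagliardo_enn s p f < \<infinity>"
  using assms by (auto simp: Wsp_def)

lemma gagliardo_enn_mono:
  fixes f g :: "'a::euclidean_space \<Rightarrow> real"
  assumes "1 < p" "\<And>x y. \<bar>f x - f y\<bar> \<le> \<bar>g x - g y\<bar>"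
  shows "gagliardo_enn s p f \<le> gagliardo_enn s p g"
  unfolding gagliardo_enn_def using assms
  by (intro nn_integral_mono ennreal_leI divide_right_mono powr_mono2) auto

text \<open>The weights stay free because two uses differ: closure of \<open>Wsp\<close> under sums
  accepts any finite constants, whereas the cut-off needs a = 1.\<close>

lemma gagliardo_enn_le_add:
  fixes f g h :: "'a::euclidean_space \<Rightarrow> real"
  assumes "g \<in> borel_measurable borel" "h \<in> borel_measurable borel" "0 \<le> a" "0 \<le> b"
    "\<And>x y. \<bar>f x - f y\<bar> powr p \<le> a * \<bar>g x - g y\<bar> powr p + b * \<bar>h x - h y\<bar> powr p"
  shows "gagliardo_enn s p f \<le> a * gagliardo_enn s p g + b * gagliardo_enn s p h"
proof -
  note [measurable] = assms(1,2)
  have "gdens s p f z \<le> a * gdens s p g z + b * gdens s p h z" for z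
    using divide_right_mono[OF assms(5)[of "fst z" "snd z"]]
    by (simp add: gdens_def add_divide_distrib)
  then have "gagliardo_enn s p f \<le>
      (\<integral>\<^sup>+ z. ennreal a * ennreal (gdens s p g z) + ennreal b * ennreal (gdens s p h z) \<partial>(lborel \<Otimes>\<^sub>M lborel))"
    unfolding gagliardo_enn_gdens using assms(3,4)
    by (intro nn_integral_mono) (auto simp flip: ennreal_plus ennreal_mult intro!: ennreal_leI)
  also have "\<dots> = a * gagliardo_enn s p g + b * gagliardo_enn s p h"
    unfolding gagliardo_enn_gdens by (subst nn_integral_add) (auto simp: nn_integral_cmult)
  finally show ?thesis .
qed

lemma Wsp_const: "1 < p \<Longrightarrow> (\<lambda>_. c) \<in> Wsp s p"
  by (auto simp: Wsp_def gagliardo_enn_def holder_bounded_def)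

lemma gagliardo_p_const: "1 < p \<Longrightarrow> gagliardo_p s p (\<lambda>_. c) = 0"
  by (simp add: gagliardo_p_def gagliardo_enn_def)

lemma gagliardo_enn_cmult:
  assumes "f \<in> borel_measurable borel"
  shows "gagliardo_enn s p (\<lambda>x. c * f x + d) = ennreal (\<bar>c\<bar> powr p) * gagliardo_enn s p f"
proof -
  note [measurable] = assms(1)
  have "gdens s p (\<lambda>x. c * f x + d) z = \<bar>c\<bar> powr p * gdens s p f z" for z
    by (simp add: gdens_def powr_mult abs_mult flip: right_diff_distrib)
  then show ?thesis
    by (simp add: gagliardo_enn_gdens ennreal_mult nn_integral_cmult)
qed

lemma gagliardo_p_cmult:
  assumes "f \<in> borel_measurable borel"
  shows "gagliardo_p s p (\<lambda>x. c * f x + d) = \<bar>c\<bar> powr p * gagliardo_p s p f"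
  by (simp add: gagliardo_p_def gagliardo_enn_cmult[OF assms] enn2real_mult)

lemma Wsp_add_cmult:
  assumes "1 < p" "f \<in> Wsp s p" "g \<in> Wsp s p"
  shows "(\<lambda>x. f x + c * g x) \<in> Wsp s p"
proof -
  obtain C where C: "0 \<le> C" "\<And>x y. \<bar>f x - f y\<bar> \<le> C * norm (x - y) powr alpha_sp s p DIM('a)"
    using holder_boundedE[OF WspD(2)[OF assms(2)]] by blast
  obtain D where D: "0 \<le> D" "\<And>x y. \<bar>g x - g y\<bar> \<le> D * norm (x - y) powr alpha_sp s p DIM('a)"
    using holder_boundedE[OF WspD(2)[OF assms(3)]] by blast
  have eq: "(f x + c * g x) - (f y + c * g y) = (f x - f y) + c * (g x - g y)" for x y
    by (simp add: algebra_simps)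
  have "holder_bounded (alpha_sp s p DIM('a)) (\<lambda>x. f x + c * g x)"
  proof (rule holder_boundedI)
    fix x y
    have "\<bar>(f x - f y) + c * (g x - g y)\<bar> \<le> \<bar>f x - f y\<bar> + \<bar>c\<bar> * \<bar>g x - g y\<bar>"
      using abs_triangle_ineq[of "f x - f y" "c * (g x - g y)"] by (simp add: abs_mult)
    also have "\<dots> \<le> C * norm (x - y) powr alpha_sp s p DIM('a)
        + \<bar>c\<bar> * (D * norm (x - y) powr alpha_sp s p DIM('a))"
      using C D by (intro add_mono mult_left_mono) auto
    finally show "\<bar>(f x + c * g x) - (f y + c * g y)\<bar>
        \<le> (C + \<bar>c\<bar> * D) * norm (x - y) powr alpha_sp s p DIM('a)"
      unfolding eq by (simp add: algebra_simps)
  qed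
  moreover have "gagliardo_enn s p (\<lambda>x. f x + c * g x) < \<infinity>"
  proof -
    have "gagliardo_enn s p (\<lambda>x. f x + c * g x) \<le>
       ennreal (2 powr p) * gagliardo_enn s p f + ennreal (2 powr p * \<bar>c\<bar> powr p) * gagliardo_enn s p g"
    proof (rule gagliardo_enn_le_add)
      show "\<bar>(f x + c * g x) - (f y + c * g y)\<bar> powr p
          \<le> 2 powr p * \<bar>f x - f y\<bar> powr p + 2 powr p * \<bar>c\<bar> powr p * \<bar>g x - g y\<bar> powr p" for x y
        using abs_add_powr_le[OF assms(1), of "f x - f y" "c * (g x - g y)"]
        unfolding eq abs_mult powr_mult by (simp add: distrib_left)
    qed (use assms in \<open>auto intro: Wsp_measurable\<close>)
    also have "\<dots> < \<infinity>"
      using WspD(3)[OF assms(2)] WspD(3)[OF assms(3)] by (simp add: ennreal_mult_less_top)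
    finally show ?thesis .
  qed
  moreover have "continuous_on UNIV (\<lambda>x. f x + c * g x)"
    using WspD(1)[OF assms(2)] WspD(1)[OF assms(3)] by (intro continuous_intros)
  ultimately show ?thesis by (simp add: Wsp_def)
qed

lemma Wsp_affine:
  assumes "1 < p" "f \<in> Wsp s p" shows "(\<lambda>x. c * f x + d) \<in> Wsp s p"
  using Wsp_add_cmult[OF assms(1) Wsp_const[OF assms(1)] assms(2)] by (simp add: add.commute)

section \<open>The first variation of the energy\<close>

definition dens_deriv ::
  "real \<Rightarrow> real \<Rightarrow> ('a::euclidean_space \<Rightarrow> real) \<Rightarrow> ('a \<Rightarrow> real) \<Rightarrow> 'a \<times> 'a \<Rightarrow> real" where
  "dens_deriv s p u f z = Jp p (u (fst z) - u (snd z)) * (f (fst z) - f (snd z))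
          / norm (fst z - snd z) powr (real DIM('a) + s * p)"

text \<open>The pairing of the fractional p-Laplacian of u with f, that is, 1/p times the derivative
  of the energy at u in direction f.\<close>

definition gpair :: "real \<Rightarrow> real \<Rightarrow> ('a::euclidean_space \<Rightarrow> real) \<Rightarrow> ('a \<Rightarrow> real) \<Rightarrow> real" where
  "gpair s p u f = (\<integral>z. dens_deriv s p u f z \<partial>(lborel \<Otimes>\<^sub>M lborel))"

lemma weak_dipole_solution_gpair:
  "weak_dipole_solution s p u c x0 y0 \<longleftrightarrow> (\<forall>f\<in>Wsp s p. gpair s p u f = c * (f x0 - f y0))"
  unfolding weak_dipole_solution_def gpair_def dens_deriv_def ..

lemma borel_measurable_dens_deriv:
  fixes u :: "'a::euclidean_space \<Rightarrow> real"
  assumes "1 < p" and [measurable]: "u \<in> borel_measurable borel" "f \<in> borel_measurable borel"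
  shows "dens_deriv s p u f \<in> borel_measurable (lborel \<Otimes>\<^sub>M lborel)"
proof -
  have [measurable]: "Jp p \<in> borel_measurable borel"
    using continuous_on_Jp[OF assms(1)] by (rule borel_measurable_continuous_onI)
  show ?thesis unfolding dens_deriv_def by measurable
qed

lemma abs_dens_deriv_add_le:
  fixes u :: "'a::euclidean_space \<Rightarrow> real"
  assumes "1 < p" "\<bar>t\<bar> \<le> 1"
  shows "\<bar>dens_deriv s p (\<lambda>x. u x + t * f x) f z\<bar> \<le> 2 powr p * (gdens s p u z + gdens s p f z)"
proof -
  have eq: "u (fst z) + t * f (fst z) - (u (snd z) + t * f (snd z))
      = (u (fst z) - u (snd z)) + t * (f (fst z) - f (snd z))" by (simp add: algebra_simps)
  show ?thesis
    using divide_right_mono[OF abs_Jp_add_mult_le[OF assms, of "u (fst z) - u (snd z)" "f (fst z) - f (snd z)"],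
        of "norm (fst z - snd z) powr (real DIM('a) + s * p)"]
    unfolding dens_deriv_def gdens_def eq by (simp add: abs_divide add_divide_distrib ring_distribs)
qed

text \<open>A Bochner integral is 0 by convention when the integrand is not integrable, so
  additivity of the pairing in its second argument rests on this.\<close>

lemma integrable_dens_deriv:
  fixes u :: "'a::euclidean_space \<Rightarrow> real"
  assumes "1 < p" "u \<in> Wsp s p" "f \<in> Wsp s p"
  shows "integrable (lborel \<Otimes>\<^sub>M lborel) (dens_deriv s p u f)"
proof (rule Bochner_Integration.integrable_bound)
  show "integrable (lborel \<Otimes>\<^sub>M lborel) (\<lambda>z. 2 powr p * (gdens s p u z + gdens s p f z))"
    using assms by (intro Bochner_Integration.integrable_mult_right Bochner_Integration.integrable_add Wsp_integrable)
  show "dens_deriv s p u f \<in> borel_measurable (lborel \<Otimes>\<^sub>M lborel)"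
    using assms by (intro borel_measurable_dens_deriv Wsp_measurable)
  show "AE z in lborel \<Otimes>\<^sub>M lborel.
      norm (dens_deriv s p u f z) \<le> norm (2 powr p * (gdens s p u z + gdens s p f z))"
    using abs_dens_deriv_add_le[OF assms(1), of 0 s u f] by (auto intro: order.trans[OF _ abs_ge_self])
qed

lemma gpair_add_cmult:
  assumes "1 < p" "u \<in> Wsp s p" "f \<in> Wsp s p" "g \<in> Wsp s p"
  shows "gpair s p u (\<lambda>x. f x + c * g x) = gpair s p u f + c * gpair s p u g"
proof -
  have "dens_deriv s p u (\<lambda>x. f x + c * g x) = (\<lambda>z. dens_deriv s p u f z + c * dens_deriv s p u g z)"
    by (rule ext) (simp add: dens_deriv_def algebra_simps add_divide_distrib diff_divide_distrib)
  then show ?thesis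
    unfolding gpair_def using integrable_dens_deriv[OF assms(1,2,3)] integrable_dens_deriv[OF assms(1,2,4)]
    by simp
qed

lemma gpair_self:
  assumes "1 < p" "u \<in> Wsp s p" shows "gpair s p u u = gagliardo_p s p u"
  unfolding gpair_def gagliardo_p_integral[OF assms(2)] dens_deriv_def gdens_def
  by (simp add: Jp_mult_self[OF assms(1)])

lemma gpair_const: "gpair s p u (\<lambda>_. c) = 0"
  by (simp add: gpair_def dens_deriv_def)

lemma gdens_subgradient:
  fixes u :: "'a::euclidean_space \<Rightarrow> real"
  assumes "1 < p"
  shows "gdens s p u z + p * dens_deriv s p u (\<lambda>x. f x - u x) z \<le> gdens s p f z"
proof -
  have eq: "f (fst z) - u (fst z) - (f (snd z) - u (snd z)) =
      f (fst z) - f (snd z) - (u (fst z) - u (snd z))" by simp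
  show ?thesis
    using divide_right_mono[OF abs_powr_subgradient[OF assms, of "u (fst z) - u (snd z)" "f (fst z) - f (snd z)"],
        of "norm (fst z - snd z) powr (real DIM('a) + s * p)"]
    unfolding dens_deriv_def gdens_def eq by (simp add: add_divide_distrib mult.assoc)
qed

lemma Wsp_diff:
  assumes "1 < p" "f \<in> Wsp s p" "g \<in> Wsp s p" shows "(\<lambda>x. f x - g x) \<in> Wsp s p"
  using Wsp_add_cmult[OF assms, of "-1"] by simp

text \<open>Convexity of the energy in the form used throughout: as soon as the pairing with f - u
  vanishes, u has at most the energy of f.\<close>

lemma gagliardo_p_subgradient:
  assumes "1 < p" "u \<in> Wsp s p" "f \<in> Wsp s p"
  shows "gagliardo_p s p u + p * gpair s p u (\<lambda>x. f x - u x) \<le> gagliardo_p s p f"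
proof -
  note int = Wsp_integrable[OF assms(2)] Wsp_integrable[OF assms(3)]
    integrable_dens_deriv[OF assms(1,2) Wsp_diff[OF assms(1,3,2)]]
  have "(\<integral>z. gdens s p u z + p * dens_deriv s p u (\<lambda>x. f x - u x) z \<partial>(lborel \<Otimes>\<^sub>M lborel)) \<le>
      (\<integral>z. gdens s p f z \<partial>(lborel \<Otimes>\<^sub>M lborel))"
    using int by (intro integral_mono gdens_subgradient[OF assms(1)]) auto
  then show ?thesis
    using int by (simp add: gpair_def gagliardo_p_integral assms)
qed

text \<open>The set where h is nonzero is open and null, and a nonempty open set is not
  negligible.\<close>

lemma continuous_AE_eq_0:
  fixes h :: "'a::euclidean_space \<Rightarrow> real"
  assumes "continuous_on UNIV h" "AE z in lborel. h z = 0"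
  shows "h z = 0"
proof -
  have op: "open {z. h z \<noteq> 0}" using assms(1) by (intro open_Collect_neq continuous_intros)
  then have "emeasure lborel {z. h z \<noteq> 0} = 0"
    using assms(2) by (subst (asm) AE_iff_measurable[of "{z. h z \<noteq> 0}"]) auto
  then have "{z. h z \<noteq> 0} = {}"
    using open_not_negligible[OF op] op
    by (auto simp: negligible_iff_null_sets null_sets_def emeasure_completion)
  then show ?thesis by auto
qed

text \<open>Equality in the subgradient inequality forces the increments to agree almost everywhere, hence,
  by continuity, everywhere.\<close>

lemma gagliardo_p_subgradient_eq:
  fixes u :: "'a::euclidean_space \<Rightarrow> real"
  assumes "1 < p" "u \<in> Wsp s p" "f \<in> Wsp s p"
    and eq: "gagliardo_p s p u + p * gpair s p u (\<lambda>x. f x - u x) = gagliardo_p s p f"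
  shows "f x - f y = u x - u y"
proof -
  note int = Wsp_integrable[OF assms(2)] Wsp_integrable[OF assms(3)]
    integrable_dens_deriv[OF assms(1,2) Wsp_diff[OF assms(1,3,2)]]
  define g where "g z = gdens s p f z - (gdens s p u z + p * dens_deriv s p u (\<lambda>x. f x - u x) z)" for z
  have "(\<integral>z. g z \<partial>(lborel \<Otimes>\<^sub>M lborel)) = 0"
    using int eq by (simp add: g_def gpair_def gagliardo_p_integral assms)
  moreover have "integrable (lborel \<Otimes>\<^sub>M lborel) g" unfolding g_def using int by auto
  moreover have "g z \<ge> 0" for z unfolding g_def using gdens_subgradient[OF assms(1), of s u z f] by simp
  ultimately have "AE z in lborel \<Otimes>\<^sub>M lborel. g z = 0"
    by (subst (asm) integral_nonneg_eq_0_iff_AE) auto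
  moreover have "f (fst z) - f (snd z) = u (fst z) - u (snd z)" if "g z = 0" for z
  proof (rule ccontr)
    assume ne: "f (fst z) - f (snd z) \<noteq> u (fst z) - u (snd z)"
    \<comment> \<open>On the diagonal both increments are zero, so differing increments place z off
      the diagonal, where the weight is positive.\<close>
    then have nz: "norm (fst z - snd z) powr (real DIM('a) + s * p) > 0" by auto
    have eq: "f (fst z) - u (fst z) - (f (snd z) - u (snd z)) =
      f (fst z) - f (snd z) - (u (fst z) - u (snd z))" by simp
    show False
      using divide_strict_right_mono[OF abs_powr_strict_subgradient[OF assms(1) ne] nz] that
      unfolding g_def dens_deriv_def gdens_def eq by (simp add: add_divide_distrib mult.assoc)
  qed
  ultimately have ae: "AE z in lborel \<Otimes>\<^sub>M lborel. f (fst z) - f (snd z) = u (fst z) - u (snd z)"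
    by (auto elim: eventually_mono)
  have cont: "continuous_on UNIV (\<lambda>z. f (fst z))" "continuous_on UNIV (\<lambda>z. f (snd z))"
    "continuous_on UNIV (\<lambda>z. u (fst z))" "continuous_on UNIV (\<lambda>z. u (snd z))"
    by (rule continuous_on_compose2[OF WspD(1)[OF assms(3)]] continuous_on_compose2[OF WspD(1)[OF assms(2)]];
        auto intro!: continuous_intros)+
  let ?h = "\<lambda>z. f (fst z) - f (snd z) - (u (fst z) - u (snd z))"
  have "continuous_on UNIV ?h" by (intro continuous_on_diff cont)
  moreover have "AE z in lborel. ?h z = 0" using ae unfolding lborel_prod by simp
  ultimately have "?h (x, y) = 0" by (rule continuous_AE_eq_0)
  then show ?thesis by simp
qed

text \<open>Minimality at \<open>u\<close> and the subgradient at \<open>u + t f\<close> give \<open>gpair (u + t f) f \<ge> 0\<close>;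
  then let \<open>t \<rightarrow> 0\<close>.\<close>

lemma gpair_eq_0_of_minimizer:
  fixes u :: "'a::euclidean_space \<Rightarrow> real"
  assumes "1 < p" "u \<in> Wsp s p" "f \<in> Wsp s p"
    and min: "\<And>t. gagliardo_p s p u \<le> gagliardo_p s p (\<lambda>x. u x + t * f x)"
  shows "gpair s p u f = 0"
proof -
  have ge: "gpair s p u g \<ge> 0"
    if g: "g \<in> Wsp s p" and min: "\<And>t. gagliardo_p s p u \<le> gagliardo_p s p (\<lambda>x. u x + t * g x)" for g
  proof -
    define t where "t n = inverse (real (Suc n))" for n
    have tpos: "0 < t n" "t n \<le> 1" for n unfolding t_def by (auto simp: inverse_le_1_iff)
    have tlim: "t \<longlonglongrightarrow> 0" unfolding t_def by (rule LIMSEQ_inverse_real_of_nat)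
    have W: "(\<lambda>x. u x + t n * g x) \<in> Wsp s p" for n using Wsp_add_cmult[OF assms(1,2) g] .
    have pos: "gpair s p (\<lambda>x. u x + t n * g x) g \<ge> 0" for n
    proof -
      have "gpair s p (\<lambda>x. u x + t n * g x) (\<lambda>x. u x - (u x + t n * g x))
          = - t n * gpair s p (\<lambda>x. u x + t n * g x) g"
        using gpair_add_cmult[OF assms(1) W[of n] Wsp_const[OF assms(1), of 0] g, of "- t n"]
        by (simp add: gpair_const)
      then have "0 \<le> p * (t n * gpair s p (\<lambda>x. u x + t n * g x) g)"
        using gagliardo_p_subgradient[OF assms(1) W[of n] assms(2)] min[of "t n"] by simp
      then show ?thesis using tpos[of n] assms(1) by (simp add: zero_le_mult_iff)
    qed
    have "(\<lambda>n. gpair s p (\<lambda>x. u x + t n * g x) g) \<longlonglongrightarrow> gpair s p u g"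
      unfolding gpair_def
    proof (rule integral_dominated_convergence)
      show "integrable (lborel \<Otimes>\<^sub>M lborel) (\<lambda>z. 2 powr p * (gdens s p u z + gdens s p g z))"
        using assms g by (intro Bochner_Integration.integrable_mult_right Bochner_Integration.integrable_add Wsp_integrable)
      show "AE z in lborel \<Otimes>\<^sub>M lborel. (\<lambda>n. dens_deriv s p (\<lambda>x. u x + t n * g x) g z) \<longlonglongrightarrow> dens_deriv s p u g z"
      proof (rule AE_I2)
        fix z
        have "(\<lambda>n. Jp p (u (fst z) + t n * g (fst z) - (u (snd z) + t n * g (snd z))))
            \<longlonglongrightarrow> Jp p (u (fst z) + 0 * g (fst z) - (u (snd z) + 0 * g (snd z)))"
          by (rule continuous_on_tendsto_compose[OF continuous_on_Jp[OF assms(1)]])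
             (auto intro!: tendsto_eq_intros tlim)
        then show "(\<lambda>n. dens_deriv s p (\<lambda>x. u x + t n * g x) g z) \<longlonglongrightarrow> dens_deriv s p u g z"
          unfolding dens_deriv_def divide_inverse by (intro tendsto_intros) simp
      qed
      show "AE z in lborel \<Otimes>\<^sub>M lborel. norm (dens_deriv s p (\<lambda>x. u x + t n * g x) g z)
          \<le> 2 powr p * (gdens s p u z + gdens s p g z)" for n
        using abs_dens_deriv_add_le[OF assms(1), of "t n" s u g] tpos[of n] by (intro AE_I2) auto
    qed (use assms g W in \<open>auto intro: borel_measurable_dens_deriv Wsp_measurable\<close>)
    then show ?thesis using pos by (intro LIMSEQ_le_const) auto
  qed
  \<comment> \<open>The one-sided inequality for f and for -f together gives equality.\<close>
  have "(\<lambda>x. - f x) \<in> Wsp s p" using Wsp_affine[OF assms(1,3), of "-1" 0] by simp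
  moreover have "gagliardo_p s p u \<le> gagliardo_p s p (\<lambda>x. u x + t * (- f x))" for t
    using min[of "- t"] by simp
  ultimately have "gpair s p u (\<lambda>x. - f x) \<ge> 0" by (rule ge)
  moreover have "gpair s p u (\<lambda>x. - f x) = - gpair s p u f"
    using gpair_add_cmult[OF assms(1,2) Wsp_const[OF assms(1), of 0] assms(3), of "-1"]
    by (simp add: gpair_const)
  moreover have "gpair s p u f \<ge> 0" using ge[OF assms(3) min] .
  ultimately show ?thesis by simp
qed

text \<open>This is the equality case of the subgradient inequality at the zero function: the
  pairing vanishes there, so zero energy forces the increments of u to be those of 0.\<close>

lemma gagliardo_p_eq_0_imp_const:
  assumes "1 < p" "u \<in> Wsp s p" "gagliardo_p s p u = 0"
  shows "u x = u y"
proof -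
  have "0 - 0 = u y - u x"
    using gagliardo_p_subgradient_eq[OF assms(1) Wsp_const[OF assms(1), of 0] assms(2), of y x] assms
    by (simp add: gagliardo_p_const gpair_def dens_deriv_def Jp_def)
  then show ?thesis by simp
qed

text \<open>The first variation vanishes on functions that are zero at both points. Constants pair
  to zero as well, so the pairing can depend only on \<open>f x0 - f y0\<close>, and
  linearly.\<close>

lemma weak_dipole_solution_of_minimizer:
  fixes u :: "'a::euclidean_space \<Rightarrow> real"
  assumes "1 < p" "u \<in> Wsp s p" "u x0 \<noteq> u y0"
    and min: "\<And>f. f \<in> Wsp s p \<Longrightarrow> f x0 = u x0 \<Longrightarrow> f y0 = u y0 \<Longrightarrow> gagliardo_p s p u \<le> gagliardo_p s p f"
  shows "\<exists>c. c \<noteq> 0 \<and> weak_dipole_solution s p u c x0 y0"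
proof -
  have 0: "gpair s p u f = 0" if "f \<in> Wsp s p" "f x0 = 0" "f y0 = 0" for f
    using that assms(1,2) by (intro gpair_eq_0_of_minimizer min Wsp_add_cmult) auto
  \<comment> \<open>Testing the equation with u itself forces this value, since the pairing of u
    with u is its energy; that energy is positive because u is not constant.\<close>
  define c where "c = gagliardo_p s p u / (u x0 - u y0)"
  have "gagliardo_p s p u \<noteq> 0"
    using gagliardo_p_eq_0_imp_const[OF assms(1,2)] assms(3) by blast
  then have "c \<noteq> 0" using assms(3) by (simp add: c_def)
  moreover have "gpair s p u f = c * (f x0 - f y0)" if f: "f \<in> Wsp s p" for f
  proof -
    \<comment> \<open>With k and d so chosen, f + k u + d vanishes at both points.\<close>
    define k where "k = - ((f x0 - f y0) / (u x0 - u y0))"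
    define d where "d = - (f y0) - k * u y0"
    have W1: "(\<lambda>x. f x + k * u x) \<in> Wsp s p" using Wsp_add_cmult[OF assms(1) f assms(2)] .
    have W2: "(\<lambda>x. f x + k * u x + 1 * d) \<in> Wsp s p"
      using Wsp_add_cmult[OF assms(1) W1 Wsp_const[OF assms(1)]] .
    have "gpair s p u (\<lambda>x. f x + k * u x + 1 * d) = 0"
      by (rule 0[OF W2]) (use assms(3) in \<open>simp_all add: d_def k_def field_simps\<close>)
    then have "gpair s p u f + k * gagliardo_p s p u = 0"
      using gpair_add_cmult[OF assms(1,2) W1 Wsp_const[OF assms(1)], of 1 d]
        gpair_add_cmult[OF assms(1,2) f assms(2), of k]
      by (simp add: gpair_const gpair_self[OF assms(1,2)])
    then show ?thesis by (simp add: k_def c_def)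
  qed
  ultimately show ?thesis by (auto simp: weak_dipole_solution_gpair)
qed

text \<open>The difference f - u vanishes at both points, so the equation removes the linear term of
  the convexity inequality. In the equality case the increments agree, and the common value at x0
  removes the remaining additive constant.\<close>

lemma weak_dipole_solution_imp_unique_minimizer:
  fixes u :: "'a::euclidean_space \<Rightarrow> real"
  assumes "1 < p" "u \<in> Wsp s p" "weak_dipole_solution s p u c x0 y0"
    and f: "f \<in> Wsp s p" "f x0 = u x0" "f y0 = u y0"
  shows "gagliardo_p s p u \<le> gagliardo_p s p f"
    and "gagliardo_p s p f = gagliardo_p s p u \<Longrightarrow> f = u"
proof -
  have 0: "gpair s p u (\<lambda>x. f x - u x) = 0"
    using assms Wsp_diff[OF assms(1) f(1) assms(2)] by (auto simp: weak_dipole_solution_gpair)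
  then show "gagliardo_p s p u \<le> gagliardo_p s p f"
    using gagliardo_p_subgradient[OF assms(1,2) f(1)] by simp
  assume "gagliardo_p s p f = gagliardo_p s p u"
  then have "f x - f x0 = u x - u x0" for x
    using gagliardo_p_subgradient_eq[OF assms(1,2) f(1)] 0 by simp
  then show "f = u" using f by auto
qed

section \<open>Invariance under similarities\<close>

lemma nn_integral_lborel_translate:
  fixes f :: "'a::euclidean_space \<Rightarrow> ennreal"
  assumes [measurable]: "f \<in> borel_measurable borel"
  shows "(\<integral>\<^sup>+x. f (c + x) \<partial>lborel) = (\<integral>\<^sup>+x. f x \<partial>lborel)"
  by (subst (2) lborel_distr_plus[of c, symmetric]) (simp add: nn_integral_distr)

lemma emeasure_lborel_ball_translate:
  fixes c :: "'a::euclidean_space" assumes "0 \<le> r"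
  shows "emeasure lborel (ball c r) = emeasure lborel (ball 0 r :: 'a set)"
  using assms by (simp add: emeasure_ball)

lemma nn_integral_lborel_scale:
  fixes f :: "'a::euclidean_space \<Rightarrow> ennreal"
  assumes [measurable]: "f \<in> borel_measurable borel" and "0 < r"
  shows "(\<integral>\<^sup>+x. f (a + r *\<^sub>R x) \<partial>lborel) = ennreal (r powr - real DIM('a)) * (\<integral>\<^sup>+x. f x \<partial>lborel)"
proof -
  have "(\<integral>\<^sup>+x. f x \<partial>lborel) = (\<integral>\<^sup>+x. f x \<partial>density (distr lborel borel (\<lambda>x. a + r *\<^sub>R x)) (\<lambda>_. \<bar>r\<bar> ^ DIM('a)))"
    using lborel_affine[of r a] assms(2) by simp
  also have "\<dots> = ennreal (r powr real DIM('a)) * (\<integral>\<^sup>+x. f (a + r *\<^sub>R x) \<partial>lborel)"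
    using assms(2) by (simp add: nn_integral_density nn_integral_distr nn_integral_cmult powr_realpow)
  finally show ?thesis
    using assms(2) by (simp add: mult.assoc[symmetric] powr_add[symmetric] flip: ennreal_mult)
qed

text \<open>Fubini against the indicator of the unit ball, as in the proof that translation invariant
  measures are unique up to a factor; the factor is one because \<open>T\<close> maps balls to balls.\<close>

lemma nn_integral_lborel_orthogonal:
  fixes f :: "'a::euclidean_space \<Rightarrow> ennreal" and T :: "'a \<Rightarrow> 'a"
  assumes [measurable]: "f \<in> borel_measurable borel" and T: "orthogonal_transformation T"
  shows "(\<integral>\<^sup>+x. f (T x) \<partial>lborel) = (\<integral>\<^sup>+x. f x \<partial>lborel)"
proof -
  define B where "B = (ball 0 1 :: 'a set)"
  have [measurable]: "B \<in> sets borel" by (simp add: B_def)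
  have lin: "linear T" using T by (rule orthogonal_transformation_linear)
  then have "continuous_on UNIV T" by (rule linear_continuous_on[OF linear_linear[THEN iffD2]])
  then have [measurable]: "T \<in> borel_measurable borel" by (rule borel_measurable_continuous_onI)
  have surj: "\<exists>w. T w = y" for y
    using orthogonal_transformation_surj[OF T] by (metis surjD)
  have b0: "emeasure lborel B \<noteq> 0"
    using less_imp_neq[OF unit_ball_vol_pos[of "real DIM('a)"]] by (simp add: B_def emeasure_ball)
  have bi: "emeasure lborel B \<noteq> top" using emeasure_lborel_ball_finite[of "0::'a" 1] by (auto simp: B_def)
  have "emeasure lborel B * (\<integral>\<^sup>+x. f (T x) \<partial>lborel)
      = (\<integral>\<^sup>+y. indicator B y * (\<integral>\<^sup>+x. f (T x) \<partial>lborel) \<partial>lborel)"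
    by (subst nn_integral_multc) auto
  also have "\<dots> = (\<integral>\<^sup>+y. \<integral>\<^sup>+x. indicator B y * f (y + T x) \<partial>lborel \<partial>lborel)"
  proof (intro nn_integral_cong)
    fix y :: 'a
    obtain w where "T w = y" using surj by blast
    then have "(\<integral>\<^sup>+x. f (y + T x) \<partial>lborel) = (\<integral>\<^sup>+x. f (T (w + x)) \<partial>lborel)"
      using linear_add[OF lin] by simp
    also have "\<dots> = (\<integral>\<^sup>+x. f (T x) \<partial>lborel)"
      by (rule nn_integral_lborel_translate) measurable
    finally show "indicator B y * (\<integral>\<^sup>+x. f (T x) \<partial>lborel) = (\<integral>\<^sup>+x. indicator B y * f (y + T x) \<partial>lborel)"
      by (simp add: nn_integral_cmult)
  qed
  also have "\<dots> = (\<integral>\<^sup>+x. \<integral>\<^sup>+y. indicator B y * f (y + T x) \<partial>lborel \<partial>lborel)"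
    by (rule lborel_pair.Fubini') measurable
  also have "\<dots> = (\<integral>\<^sup>+x. \<integral>\<^sup>+y. indicator B (y - T x) * f y \<partial>lborel \<partial>lborel)"
  proof (rule nn_integral_cong)
    fix x
    show "(\<integral>\<^sup>+y. indicator B y * f (y + T x) \<partial>lborel) = (\<integral>\<^sup>+y. indicator B (y - T x) * f y \<partial>lborel)"
      by (subst nn_integral_lborel_translate[symmetric, of "\<lambda>y. indicator B (y - T x) * f y" "T x"])
         (simp_all add: add.commute)
  qed
  also have "\<dots> = (\<integral>\<^sup>+y. \<integral>\<^sup>+x. indicator B (y - T x) * f y \<partial>lborel \<partial>lborel)"
    by (rule lborel_pair.Fubini') measurable
  also have "\<dots> = (\<integral>\<^sup>+y. emeasure lborel B * f y \<partial>lborel)"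
  proof (intro nn_integral_cong)
    fix y :: 'a
    obtain w where w: "T w = y" using surj by blast
    \<comment> \<open>Since y = T w, the vector y - T x is T (w - x), which has the length of w -
      x.\<close>
    have "indicator B (y - T x) = (indicator (ball w 1) x :: ennreal)" for x
      using orthogonal_transformation_norm[OF T, of "w - x"] linear_diff[OF lin, of w x] w
      by (auto simp: B_def indicator_def dist_norm norm_minus_commute)
    then have "(\<integral>\<^sup>+x. indicator B (y - T x) * f y \<partial>lborel) = (\<integral>\<^sup>+x. indicator (ball w 1) x * f y \<partial>lborel)"
      by (intro nn_integral_cong) simp
    also have "\<dots> = emeasure lborel (ball w 1) * f y"
      by (subst nn_integral_multc) (auto intro!: borel_measurable_indicator)
    also have "emeasure lborel (ball w 1) = emeasure lborel B"
      unfolding B_def by (rule emeasure_lborel_ball_translate) simp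
    finally show "(\<integral>\<^sup>+x. indicator B (y - T x) * f y \<partial>lborel) = emeasure lborel B * f y" .
  qed
  also have "\<dots> = emeasure lborel B * (\<integral>\<^sup>+y. f y \<partial>lborel)"
    by (simp add: nn_integral_cmult)
  finally show ?thesis using b0 bi by (simp add: ennreal_mult_cancel_left)
qed

text \<open>The decomposition is built in so that a change of variables splits into the orthogonal
  and the affine case.\<close>

definition similarity :: "real \<Rightarrow> ('a::euclidean_space \<Rightarrow> 'a) \<Rightarrow> bool" where
  "similarity r S \<longleftrightarrow> 0 < r \<and> (\<exists>a T. orthogonal_transformation T \<and> S = (\<lambda>x. a + r *\<^sub>R T x))"

lemma similarity_norm:
  assumes "similarity r S" shows "norm (S x - S y) = r * norm (x - y)"
proof -
  obtain a T where T: "orthogonal_transformation T" and S: "S = (\<lambda>x. a + r *\<^sub>R T x)" and r: "0 < r"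
    using assms unfolding similarity_def by blast
  have "S x - S y = r *\<^sub>R T (x - y)"
    by (simp add: S linear_diff[OF orthogonal_transformation_linear[OF T]] scaleR_diff_right)
  then show ?thesis using r by (simp add: orthogonal_transformation_norm[OF T])
qed

lemma similarity_continuous_on:
  assumes "similarity r S" shows "continuous_on UNIV S"
proof -
  obtain a T where T: "orthogonal_transformation T" and S: "S = (\<lambda>x. a + r *\<^sub>R T x)" and r: "0 < r"
    using assms unfolding similarity_def by blast
  have "continuous_on UNIV T"
    using orthogonal_transformation_linear[OF T] by (rule linear_continuous_on[OF linear_linear[THEN iffD2]])
  then show ?thesis unfolding S by (intro continuous_intros)
qed

lemma nn_integral_lborel_similarity:
  fixes f :: "'a::euclidean_space \<Rightarrow> ennreal"
  assumes [measurable]: "f \<in> borel_measurable borel" and "similarity r S"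
  shows "(\<integral>\<^sup>+x. f (S x) \<partial>lborel) = ennreal (r powr - real DIM('a)) * (\<integral>\<^sup>+x. f x \<partial>lborel)"
proof -
  obtain a T where T: "orthogonal_transformation T" and S: "S = (\<lambda>x. a + r *\<^sub>R T x)" and r: "0 < r"
    using assms unfolding similarity_def by blast
  have "(\<integral>\<^sup>+x. f (S x) \<partial>lborel) = (\<integral>\<^sup>+x. f (a + r *\<^sub>R x) \<partial>lborel)"
    unfolding S by (rule nn_integral_lborel_orthogonal[OF _ T]) measurable
  then show ?thesis using nn_integral_lborel_scale[OF assms(1) r] by simp
qed

text \<open>The exponent is (N + s p) - 2 N: the kernel contributes r^(N + s p), and each of the two
  variables a Jacobian r^(-N).\<close>

lemma gagliardo_enn_similarity:
  fixes f :: "'a::euclidean_space \<Rightarrow> real"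
  assumes [measurable]: "f \<in> borel_measurable borel" and S: "similarity r S"
  shows "gagliardo_enn s p (\<lambda>x. f (S x)) = ennreal (r powr (s * p - real DIM('a))) * gagliardo_enn s p f"
proof -
  have [measurable]: "S \<in> borel_measurable borel"
    using similarity_continuous_on[OF S] by (rule borel_measurable_continuous_onI)
  have r: "0 < r" using S by (simp add: similarity_def)
  let ?q = "real DIM('a) + s * p"
  have D: "ennreal (gdens s p (\<lambda>x. f (S x)) (x, y)) = ennreal (r powr ?q) * ennreal (gdens s p f (S x, S y))" for x y
    using r by (simp add: gdens_def similarity_norm[OF S] powr_mult flip: ennreal_mult)
  have "gagliardo_enn s p (\<lambda>x. f (S x)) =
      (\<integral>\<^sup>+x. \<integral>\<^sup>+y. ennreal (gdens s p (\<lambda>x. f (S x)) (x, y)) \<partial>lborel \<partial>lborel)"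
    unfolding gagliardo_enn_gdens by (rule lborel.nn_integral_fst[symmetric]) measurable
  also have "\<dots> = ennreal (r powr ?q) * (\<integral>\<^sup>+x. \<integral>\<^sup>+y. ennreal (gdens s p f (S x, S y)) \<partial>lborel \<partial>lborel)"
    unfolding D by (simp add: nn_integral_cmult)
  also have "(\<integral>\<^sup>+x. \<integral>\<^sup>+y. ennreal (gdens s p f (S x, S y)) \<partial>lborel \<partial>lborel)
      = (\<integral>\<^sup>+x. ennreal (r powr - real DIM('a)) * (\<integral>\<^sup>+y. ennreal (gdens s p f (S x, y)) \<partial>lborel) \<partial>lborel)"
    by (intro nn_integral_cong nn_integral_lborel_similarity[OF _ S]) measurable
  also have "\<dots> = ennreal (r powr - real DIM('a)) * (\<integral>\<^sup>+x. (\<integral>\<^sup>+y. ennreal (gdens s p f (S x, y)) \<partial>lborel) \<partial>lborel)"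
    by (rule nn_integral_cmult) measurable
  also have "(\<integral>\<^sup>+x. (\<integral>\<^sup>+y. ennreal (gdens s p f (S x, y)) \<partial>lborel) \<partial>lborel)
      = ennreal (r powr - real DIM('a)) * (\<integral>\<^sup>+x. (\<integral>\<^sup>+y. ennreal (gdens s p f (x, y)) \<partial>lborel) \<partial>lborel)"
    by (rule nn_integral_lborel_similarity[OF _ S]) measurable
  also have "(\<integral>\<^sup>+x. (\<integral>\<^sup>+y. ennreal (gdens s p f (x, y)) \<partial>lborel) \<partial>lborel) = gagliardo_enn s p f"
    unfolding gagliardo_enn_gdens by (rule lborel.nn_integral_fst) measurable
  finally show ?thesis
    by (simp add: mult.assoc[symmetric] powr_add[symmetric] flip: ennreal_mult)
qed

lemma Wsp_similarity:
  fixes f :: "'a::euclidean_space \<Rightarrow> real"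
  assumes f: "f \<in> Wsp s p" and S: "similarity r S"
  shows "(\<lambda>x. f (S x)) \<in> Wsp s p"
proof -
  let ?\<alpha> = "alpha_sp s p DIM('a)"
  obtain C where C: "0 \<le> C" "\<And>x y. \<bar>f x - f y\<bar> \<le> C * norm (x - y) powr ?\<alpha>"
    using holder_boundedE[OF WspD(2)[OF f]] by blast
  have "0 < r" using S by (simp add: similarity_def)
  then have "\<bar>f (S x) - f (S y)\<bar> \<le> (C * r powr ?\<alpha>) * norm (x - y) powr ?\<alpha>" for x y
    using C(2)[of "S x" "S y"] by (simp add: similarity_norm[OF S] powr_mult mult.assoc)
  then have "holder_bounded ?\<alpha> (\<lambda>x. f (S x))" by (rule holder_boundedI)
  moreover have "continuous_on UNIV (\<lambda>x. f (S x))"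
    using continuous_on_compose2[OF WspD(1)[OF f] similarity_continuous_on[OF S]] by simp
  moreover have "gagliardo_enn s p (\<lambda>x. f (S x)) < \<infinity>"
    using WspD(3)[OF f] by (simp add: gagliardo_enn_similarity[OF Wsp_measurable[OF f] S] ennreal_mult_less_top)
  ultimately show ?thesis by (simp add: Wsp_def)
qed

lemma gagliardo_p_similarity:
  fixes f :: "'a::euclidean_space \<Rightarrow> real"
  assumes "f \<in> Wsp s p" "similarity r S"
  shows "gagliardo_p s p (\<lambda>x. f (S x)) = r powr (s * p - real DIM('a)) * gagliardo_p s p f"
  by (simp add: gagliardo_p_def gagliardo_enn_similarity[OF Wsp_measurable[OF assms(1)] assms(2)] enn2real_mult)

section \<open>Transitivity of similarities on pairs of distinct points\<close>

lemma orthogonal_transformation_reflection: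
  fixes v :: "'a::euclidean_space"
  shows "orthogonal_transformation (\<lambda>x. x - (2 * (x \<bullet> v) / (v \<bullet> v)) *\<^sub>R v)"
proof -
  have "linear (\<lambda>x. x - (2 * (x \<bullet> v) / (v \<bullet> v)) *\<^sub>R v)"
    by (rule linearI)
       (simp_all add: inner_add_left add_divide_distrib distrib_left scaleR_add_left scaleR_diff_right)
  moreover have "(x - (2 * (x \<bullet> v) / (v \<bullet> v)) *\<^sub>R v) \<bullet> (y - (2 * (y \<bullet> v) / (v \<bullet> v)) *\<^sub>R v) = x \<bullet> y" for x y
  \<comment> \<open>For v = 0 the map is the identity.\<close>
  proof (cases "v = 0")
    case False
    define d where "d = v \<bullet> v"
    have "d \<noteq> 0" using False by (simp add: d_def)
    then show ?thesis
      unfolding inner_diff_left inner_diff_right inner_scaleR_left inner_scaleR_right inner_commute[of v y] d_def[symmetric]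
      by (simp add: field_simps)
  qed simp
  ultimately show ?thesis unfolding orthogonal_transformation_def by blast
qed

text \<open>For vectors of equal length, the reflection along a - b sends a to b, because twice the
  inner product of a with a - b is |a - b|^2. Unlike rotations, reflections achieve this in
  dimension one as well.\<close>

lemma orthogonal_transformation_exists_euclidean:
  fixes a b :: "'a::euclidean_space"
  assumes "norm a = norm b"
  shows "\<exists>T. orthogonal_transformation T \<and> T a = b"
proof (cases "a = b")
  case False
  let ?v = "a - b"
  have "a \<bullet> a = b \<bullet> b" using assms by (simp add: norm_eq)
  then have "2 * (a \<bullet> ?v) = ?v \<bullet> ?v" by (simp add: inner_diff_left inner_diff_right inner_commute)
  then have "a - (2 * (a \<bullet> ?v) / (?v \<bullet> ?v)) *\<^sub>R ?v = b" using False by simp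
  then show ?thesis using orthogonal_transformation_reflection[of ?v] by blast
qed (auto intro!: exI[of _ "\<lambda>x. x"])

text \<open>The distances fix the ratio, the directions the orthogonal part, and the image of y0 the
  translation.\<close>

lemma similarity_exists:
  fixes x0 y0 x y :: "'a::euclidean_space"
  assumes "x0 \<noteq> y0" "x \<noteq> y"
  shows "\<exists>S. similarity (norm (x - y) / norm (x0 - y0)) S \<and> S x0 = x \<and> S y0 = y"
proof -
  let ?r = "norm (x - y) / norm (x0 - y0)"
  have r: "0 < ?r" using assms by simp
  have "norm (x0 - y0) = norm ((1 / ?r) *\<^sub>R (x - y))" using assms by simp
  then obtain T where T: "orthogonal_transformation T" "T (x0 - y0) = (1 / ?r) *\<^sub>R (x - y)"
    using orthogonal_transformation_exists_euclidean by blast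
  have "?r *\<^sub>R T x0 - ?r *\<^sub>R T y0 = ?r *\<^sub>R T (x0 - y0)"
    by (simp add: linear_diff[OF orthogonal_transformation_linear[OF T(1)]] scaleR_diff_right)
  also have "\<dots> = x - y" unfolding T(2) using assms by simp
  finally have "?r *\<^sub>R T x0 - ?r *\<^sub>R T y0 = x - y" .
  then have "(y - ?r *\<^sub>R T y0) + ?r *\<^sub>R T x0 = x" by (simp add: algebra_simps)
  moreover have "similarity ?r (\<lambda>w. (y - ?r *\<^sub>R T y0) + ?r *\<^sub>R T w)"
    using r T(1) unfolding similarity_def by blast
  ultimately show ?thesis by (intro exI[of _ "\<lambda>w. (y - ?r *\<^sub>R T y0) + ?r *\<^sub>R T w"]) simp
qed

lemma similarity_scale: "0 < r \<Longrightarrow> similarity r (\<lambda>x. r *\<^sub>R x)"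
  unfolding similarity_def
  by (auto intro!: exI[of _ 0] exI[of _ "\<lambda>x. x"])

lemma similarity_translate: "similarity 1 (\<lambda>x. c + x)"
  unfolding similarity_def
  by (auto intro!: exI[of _ c] exI[of _ "\<lambda>x. x"])

section \<open>Compactly supported functions of finite energy\<close>

text \<open>This replaces polar coordinates. On the shell R k <= |h| < 2 R k the integrand is at
  most a constant times R k^\<gamma>, and the shell lies in a ball of volume of order R k^N. A
  general sequence of radii covers both the singularity at zero and the decay at infinity.\<close>

lemma nn_integral_norm_powr_dyadic:
  fixes R :: "nat \<Rightarrow> real" and A :: "'a::euclidean_space set"
  assumes [measurable]: "A \<in> sets borel" and R: "\<And>k. 0 < R k"
    and cover: "\<And>h. h \<in> A \<Longrightarrow> \<exists>k. R k \<le> norm h \<and> norm h < 2 * R k"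
    and sm: "summable (\<lambda>k. R k powr (\<gamma> + real DIM('a)))"
  shows "(\<integral>\<^sup>+h. ennreal (norm h powr \<gamma>) * indicator A h \<partial>lborel) < \<infinity>"
proof -
  \<comment> \<open>Within a shell the power is largest at the outer radius if \<gamma> >= 0 and at
    the inner one otherwise; C covers both cases.\<close>
  define C where "C = max 1 (2 powr \<gamma>)"
  define D where "D = C * unit_ball_vol (real DIM('a)) * 2 powr real DIM('a)"
  have C: "C \<ge> 0" by (simp add: C_def)
  have D: "D \<ge> 0" using C unit_ball_vol_nonneg[of "real DIM('a)"] by (simp add: D_def)
  have "(\<integral>\<^sup>+h. ennreal (norm h powr \<gamma>) * indicator A h \<partial>lborel)
      \<le> (\<integral>\<^sup>+h. (\<Sum>k. ennreal (C * R k powr \<gamma>) * indicator (ball 0 (2 * R k)) h) \<partial>(lborel::'a measure))"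
  proof (rule nn_integral_mono)
    fix h :: 'a
    show "ennreal (norm h powr \<gamma>) * indicator A h
        \<le> (\<Sum>k. ennreal (C * R k powr \<gamma>) * indicator (ball 0 (2 * R k)) h)"
    proof (cases "h \<in> A")
      case True
      then obtain k where k: "R k \<le> norm h" "norm h < 2 * R k" using cover by blast
      have "norm h powr \<gamma> \<le> C * R k powr \<gamma>"
      proof (cases "\<gamma> \<ge> 0")
        case True
        have "norm h powr \<gamma> \<le> (2 * R k) powr \<gamma>" using k True by (intro powr_mono2) auto
        also have "\<dots> = 2 powr \<gamma> * R k powr \<gamma>" by (simp add: powr_mult)
        also have "\<dots> \<le> C * R k powr \<gamma>" by (intro mult_right_mono) (auto simp: C_def)
        finally show ?thesis .
      next
        case False
        have "norm h powr \<gamma> \<le> 1 * R k powr \<gamma>" using k R[of k] False by (simp add: powr_mono2')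
        also have "\<dots> \<le> C * R k powr \<gamma>" by (intro mult_right_mono) (auto simp: C_def)
        finally show ?thesis .
      qed
      then have "ennreal (norm h powr \<gamma>) * indicator A h
          \<le> (\<Sum>k\<in>{k}. ennreal (C * R k powr \<gamma>) * indicator (ball 0 (2 * R k)) h)"
        using k True by (simp add: ennreal_leI)
      also have "\<dots> \<le> (\<Sum>k. ennreal (C * R k powr \<gamma>) * indicator (ball 0 (2 * R k)) h)"
        by (intro sum_le_suminf) auto
      finally show ?thesis .
    qed simp
  qed
  moreover have "(\<integral>\<^sup>+h. (\<Sum>k. ennreal (C * R k powr \<gamma>) * indicator (ball 0 (2 * R k)) h) \<partial>(lborel::'a measure))
      = (\<Sum>k. \<integral>\<^sup>+h. ennreal (C * R k powr \<gamma>) * indicator (ball 0 (2 * R k)) h \<partial>(lborel::'a measure))"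
    by (intro nn_integral_suminf borel_measurable_times_ennreal borel_measurable_const
        borel_measurable_indicator) simp
  moreover have "(\<integral>\<^sup>+h. ennreal (C * R k powr \<gamma>) * indicator (ball 0 (2 * R k)) h \<partial>(lborel::'a measure))
      = ennreal (D * R k powr (\<gamma> + real DIM('a)))" for k
  proof -
    have "(\<integral>\<^sup>+h. ennreal (C * R k powr \<gamma>) * indicator (ball 0 (2 * R k)) h \<partial>(lborel::'a measure))
        = ennreal (C * R k powr \<gamma>) * ennreal (unit_ball_vol (real DIM('a)) * (2 * R k) powr real DIM('a))"
      using R[of k] by (subst nn_integral_cmult_indicator) (simp_all add: emeasure_ball powr_realpow)
    also have "\<dots> = ennreal (D * R k powr (\<gamma> + real DIM('a)))"
      using R[of k] C unit_ball_vol_nonneg[of "real DIM('a)"]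
      by (subst ennreal_mult[symmetric]) (simp_all add: D_def powr_mult powr_add)
    finally show ?thesis .
  qed
  moreover have "(\<Sum>k. ennreal (D * R k powr (\<gamma> + real DIM('a)))) < \<infinity>"
    using sm D by (subst suminf_ennreal2) (auto intro!: summable_mult)
  ultimately show ?thesis by simp
qed

lemma nn_integral_norm_powr_outside:
  assumes "\<gamma> + real DIM('a) < 0"
  shows "(\<integral>\<^sup>+h. ennreal (norm h powr \<gamma>) * indicator {h. 1 \<le> norm h} h \<partial>(lborel::'a::euclidean_space measure)) < \<infinity>"
proof (rule nn_integral_norm_powr_dyadic[where R = "\<lambda>k. 2 ^ k"])
  show "\<exists>k. 2 ^ k \<le> norm h \<and> norm h < 2 * 2 ^ k" if h: "h \<in> {h. 1 \<le> norm h}" for h :: 'a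
  proof -
    obtain n where "norm h < 2 ^ n" using real_arch_pow[of 2 "norm h"] by auto
    then have n: "norm h < 2 ^ (LEAST n. norm h < 2 ^ n)" by (rule LeastI)
    \<comment> \<open>The least exponent is not 0 because |h| >= 1; its predecessor indexes the
      shell.\<close>
    obtain k where k: "(LEAST n. norm h < 2 ^ n) = Suc k"
      using n h by (cases "LEAST n. norm h < 2 ^ n") auto
    then have "\<not> norm h < 2 ^ k" by (intro not_less_Least) simp
    then show ?thesis using n unfolding k by (intro exI[of _ k]) auto
  qed
  have eq: "(2 ^ k :: real) powr (\<gamma> + real DIM('a)) = (2 powr (\<gamma> + real DIM('a))) ^ k" for k
    by (simp add: powr_powr powr_realpow[symmetric] mult.commute)
  show "summable (\<lambda>k. (2 ^ k :: real) powr (\<gamma> + real DIM('a)))"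
    unfolding eq using assms powr_less_mono[of "\<gamma> + real DIM('a)" 0 2] by (intro summable_geometric) simp
qed auto

lemma nn_integral_norm_powr_inside:
  assumes "\<gamma> + real DIM('a) > 0"
  shows "(\<integral>\<^sup>+h. ennreal (norm h powr \<gamma>) * indicator {h. 0 < norm h \<and> norm h < 1} h \<partial>(lborel::'a::euclidean_space measure)) < \<infinity>"
proof (rule nn_integral_norm_powr_dyadic[where R = "\<lambda>k. (1 / 2) ^ k"])
  show "\<exists>k. (1 / 2) ^ k \<le> norm h \<and> norm h < 2 * (1 / 2) ^ k" if h: "h \<in> {h. 0 < norm h \<and> norm h < 1}" for h :: 'a
  proof -
    obtain n where "(1 / 2) ^ n < norm h" using real_arch_pow_inv[of "norm h" "1 / 2"] h by auto
    then have "(1 / 2) ^ n \<le> norm h" by simp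
    then have n: "(1 / 2) ^ (LEAST n. (1 / 2) ^ n \<le> norm h) \<le> norm h" by (rule LeastI)
    \<comment> \<open>The least exponent is not 0 because |h| < 1. This time it indexes the shell
      itself, and minimality against its predecessor gives the upper bound.\<close>
    obtain k where k: "(LEAST n. (1 / 2) ^ n \<le> norm h) = Suc k"
      using n h by (cases "LEAST n. (1 / 2) ^ n \<le> norm h") auto
    then have "\<not> (1 / 2) ^ k \<le> norm h" by (intro not_less_Least) simp
    then show ?thesis using n unfolding k by (intro exI[of _ "Suc k"]) auto
  qed
  have eq: "((1 / 2) ^ k :: real) powr (\<gamma> + real DIM('a)) = ((1 / 2) powr (\<gamma> + real DIM('a))) ^ k" for k
    by (simp add: powr_powr powr_realpow[symmetric] mult.commute)
  have "(1 / 2) powr (\<gamma> + real DIM('a)) < 1"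
    using assms powr_less_mono2[of "\<gamma> + real DIM('a)" "1 / 2" 1] by simp
  then show "summable (\<lambda>k. ((1 / 2) ^ k :: real) powr (\<gamma> + real DIM('a)))"
    unfolding eq by (intro summable_geometric) simp
qed auto

section \<open>The Hoelder exponent, and membership of Lipschitz and of test functions\<close>

lemma alpha_sp_bounds:
  assumes "0 < s" "s < 1" "1 < p" "s * p > real N"
  shows "0 < alpha_sp s p N" "alpha_sp s p N < 1"
proof -
  show "0 < alpha_sp s p N" using assms by (simp add: alpha_sp_def field_simps)
  have "0 \<le> real N / p" using assms by simp
  then show "alpha_sp s p N < 1" using assms unfolding alpha_sp_def by linarith
qed

text \<open>Near the diagonal the Lipschitz bound leaves |h|^(p - N - s p), integrable at zero
  because s < 1. Away from it boundedness leaves |h|^(-N - s p), integrable at infinity because s p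
  > 0. Compact support confines the other variable to a set of finite measure.\<close>

lemma lipschitz_compact_support_in_Wsp:
  fixes f :: "'a::euclidean_space \<Rightarrow> real"
  assumes sp: "0 < s" "s < 1" "1 < p" "s * p > real DIM('a)"
    and lip: "\<And>x y. \<bar>f x - f y\<bar> \<le> L * norm (x - y)"
    and supp: "\<And>x. R \<le> norm x \<Longrightarrow> f x = 0"
  shows "f \<in> Wsp s p"
proof -
  \<comment> \<open>The sign of L is read off from the Lipschitz bound at 0 and a basis vector, two
    distinct points.\<close>
  have "L * norm (0 - (SOME b. b \<in> Basis :: 'a)) \<ge> 0"
    by (rule order.trans[OF abs_ge_zero lip])
  then have L: "L \<ge> 0" by (simp add: some_in_eq)
  define B where "B = \<bar>f 0\<bar> + L * \<bar>R\<bar>"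
  have B0: "0 \<le> B" using L by (simp add: B_def)
  have B: "\<bar>f x\<bar> \<le> B" for x
  proof (cases "R \<le> norm x")
    case False
    have "\<bar>f x - f 0\<bar> \<le> L * norm x" using lip[of x 0] by simp
    also have "\<dots> \<le> L * \<bar>R\<bar>" using False L by (intro mult_left_mono) auto
    finally show ?thesis by (simp add: B_def)
  qed (use B0 supp in simp)
  have BB: "\<bar>f x - f y\<bar> \<le> 2 * B" for x y using B[of x] B[of y] by linarith
  have cont: "continuous_on UNIV f"
    by (rule lipschitz_on_continuous_on[of L]) (use lip L in \<open>auto simp: lipschitz_on_def dist_norm\<close>)
  then have [measurable]: "f \<in> borel_measurable borel" by (rule borel_measurable_continuous_onI)
  let ?\<alpha> = "alpha_sp s p DIM('a)"
  note \<alpha> = alpha_sp_bounds[OF sp]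
  have "holder_bounded ?\<alpha> f"
  proof (rule holder_boundedI)
    fix x y
    show "\<bar>f x - f y\<bar> \<le> (L + 2 * B) * norm (x - y) powr ?\<alpha>"
    proof (cases "norm (x - y) \<le> 1")
      case True
      have "norm (x - y) powr 1 \<le> norm (x - y) powr ?\<alpha>" using True \<alpha> by (intro powr_mono') auto
      then have "L * norm (x - y) \<le> L * norm (x - y) powr ?\<alpha>" using L by (intro mult_left_mono) auto
      also have "\<dots> \<le> (L + 2 * B) * norm (x - y) powr ?\<alpha>" using B0 by (intro mult_right_mono) auto
      finally show ?thesis using lip[of x y] by linarith
    next
      case False
      then have "1 \<le> norm (x - y) powr ?\<alpha>" using \<alpha> by (intro ge_one_powr_ge_zero) auto
      then have "2 * B * 1 \<le> 2 * B * norm (x - y) powr ?\<alpha>" using B0 by (intro mult_left_mono) auto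
      also have "\<dots> \<le> (L + 2 * B) * norm (x - y) powr ?\<alpha>" using L by (intro mult_right_mono) auto
      finally show ?thesis using BB[of x y] by linarith
    qed
  qed
  moreover have "gagliardo_enn s p f < \<infinity>"
  proof -
    define q where "q = real DIM('a) + s * p"
    define K where "K = (ball 0 \<bar>R\<bar> :: 'a set)"
    define g :: "'a \<Rightarrow> ennreal" where "g h =
      ennreal (L powr p) * (ennreal (norm h powr (p - q)) * indicator {h. 0 < norm h \<and> norm h < 1} h) +
      ennreal ((2 * B) powr p) * (ennreal (norm h powr (- q)) * indicator {h. 1 \<le> norm h} h)" for h
    have [measurable]: "K \<in> sets borel" by (simp add: K_def)
    have K: "emeasure lborel K < \<infinity>" unfolding K_def by (rule emeasure_lborel_ball_finite)
    have gm [measurable]: "g \<in> borel_measurable borel" unfolding g_def by measurable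
    have s1: "s * p < p" using sp by simp
    have G: "(\<integral>\<^sup>+h. g h \<partial>lborel) < \<infinity>"
    proof -
      have "(\<integral>\<^sup>+h. g h \<partial>lborel) =
        ennreal (L powr p) * (\<integral>\<^sup>+h. ennreal (norm h powr (p - q)) * indicator {h. 0 < norm h \<and> norm h < 1} h \<partial>(lborel::'a measure)) +
        ennreal ((2 * B) powr p) * (\<integral>\<^sup>+h. ennreal (norm h powr (- q)) * indicator {h. 1 \<le> norm h} h \<partial>(lborel::'a measure))"
        unfolding g_def by (subst nn_integral_add) (simp_all add: nn_integral_cmult)
      also have "\<dots> < \<infinity>"
        using nn_integral_norm_powr_inside[where ?'a='a, of "p - q"]
          nn_integral_norm_powr_outside[where ?'a='a, of "- q"] sp s1
        by (simp add: q_def ennreal_mult_less_top)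
      finally show ?thesis .
    qed
    have geven: "g (x - y) = g (y - x)" for x y by (simp add: g_def norm_minus_commute indicator_def)
    have T1: "(\<integral>\<^sup>+y. g (y - x) \<partial>lborel) = (\<integral>\<^sup>+h. g h \<partial>lborel)" for x
      using nn_integral_lborel_translate[OF gm, of "- x"] by simp
    have T2: "(\<integral>\<^sup>+y. g (x - y) \<partial>lborel) = (\<integral>\<^sup>+h. g h \<partial>lborel)" for x
      using T1[of x] by (simp add: geven)
    \<comment> \<open>A pair contributes only if one of its points lies in K. With one summand for
      each possibility, the free variable can be integrated first, by translation
      invariance.\<close>
    have pw: "ennreal (gdens s p f (x, y)) \<le> indicator K x * g (y - x) + indicator K y * g (y - x)" for x y
    proof (cases "x = y \<or> (x \<notin> K \<and> y \<notin> K)")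
      case True
      then have "f x = f y" using supp by (auto simp: K_def)
      then show ?thesis by (simp add: gdens_def)
    next
      case False
      have "ennreal (gdens s p f (x, y)) \<le> g (y - x)"
      proof (cases "norm (y - x) < 1")
        case True
        have "\<bar>f x - f y\<bar> powr p \<le> (L * norm (y - x)) powr p"
          using lip[of x y] sp by (intro powr_mono2) (auto simp: norm_minus_commute)
        then have "gdens s p f (x, y) \<le> (L * norm (y - x)) powr p / norm (y - x) powr q"
          by (simp add: gdens_def q_def norm_minus_commute divide_right_mono)
        also have "\<dots> = L powr p * norm (y - x) powr (p - q)" by (simp add: powr_mult powr_diff)
        finally show ?thesis using True False
          by (auto simp: g_def intro!: ennreal_leI simp flip: ennreal_mult)
      next
        case nf: False
        have "\<bar>f x - f y\<bar> powr p \<le> (2 * B) powr p"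
          using BB[of x y] sp by (intro powr_mono2) auto
        then have "gdens s p f (x, y) \<le> (2 * B) powr p / norm (y - x) powr q"
          by (simp add: gdens_def q_def norm_minus_commute divide_right_mono)
        also have "\<dots> = (2 * B) powr p * norm (y - x) powr (- q)" by (simp add: powr_minus divide_inverse)
        finally show ?thesis using nf False
          by (auto simp: g_def intro!: ennreal_leI simp flip: ennreal_mult)
      qed
      also have "\<dots> \<le> indicator K x * g (y - x) + indicator K y * g (y - x)"
        using False by (auto simp: indicator_def)
      finally show ?thesis .
    qed
    have "gagliardo_enn s p f = (\<integral>\<^sup>+x. \<integral>\<^sup>+y. ennreal (gdens s p f (x, y)) \<partial>lborel \<partial>lborel)"
      unfolding gagliardo_enn_gdens by (rule lborel.nn_integral_fst[symmetric]) measurable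
    also have "\<dots> \<le> (\<integral>\<^sup>+x. \<integral>\<^sup>+y. indicator K x * g (y - x) + indicator K y * g (y - x) \<partial>lborel \<partial>lborel)"
      by (intro nn_integral_mono pw)
    also have "\<dots> = (\<integral>\<^sup>+x. \<integral>\<^sup>+y. indicator K x * g (y - x) \<partial>lborel \<partial>lborel)
        + (\<integral>\<^sup>+x. \<integral>\<^sup>+y. indicator K y * g (y - x) \<partial>lborel \<partial>lborel)"
      by (subst nn_integral_add[symmetric]) (auto intro!: nn_integral_cong nn_integral_add)
    also have "(\<integral>\<^sup>+x. \<integral>\<^sup>+y. indicator K y * g (y - x) \<partial>lborel \<partial>lborel)
        = (\<integral>\<^sup>+y. \<integral>\<^sup>+x. indicator K y * g (y - x) \<partial>lborel \<partial>lborel)"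
      by (rule lborel_pair.Fubini') measurable
    also have "(\<integral>\<^sup>+x. \<integral>\<^sup>+y. indicator K x * g (y - x) \<partial>lborel \<partial>lborel)
        + (\<integral>\<^sup>+y. \<integral>\<^sup>+x. indicator K y * g (y - x) \<partial>lborel \<partial>lborel)
        = emeasure lborel K * (\<integral>\<^sup>+h. g h \<partial>lborel) + emeasure lborel K * (\<integral>\<^sup>+h. g h \<partial>lborel)"
      by (simp add: nn_integral_cmult nn_integral_multc T1 T2)
    also have "\<dots> < \<infinity>" using K G by (simp add: ennreal_mult_less_top)
    finally show ?thesis .
  qed
  ultimately show ?thesis using cont by (simp add: Wsp_def)
qed

text \<open>The partial derivatives are bounded, so moving one coordinate at a time gives a Lipschitz bound.\<close>

lemma test_fun_in_Wsp:
  fixes f :: "'a::euclidean_space \<Rightarrow> real"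
  assumes sp: "0 < s" "s < 1" "1 < p" "s * p > real DIM('a)" and f: "test_fun f"
  shows "f \<in> Wsp s p"
proof -
  define K where "K = closure {x. f x \<noteq> 0}"
  have K: "compact K" and sm: "smooth_fun f" using f by (auto simp: test_fun_def K_def)
  have diff: "(\<lambda>t. f (x + t *\<^sub>R v)) differentiable (at 0)" if "v \<in> Basis" for x v
    using sm that unfolding smooth_fun_def by (auto dest!: spec[of _ "[]"])
  have der: "((\<lambda>t. f (x + t *\<^sub>R v)) has_real_derivative partial_deriv v f (x + t *\<^sub>R v)) (at t)"
    if "v \<in> Basis" for x v t
  proof -
    have "((\<lambda>h. f ((x + t *\<^sub>R v) + h *\<^sub>R v)) has_real_derivative partial_deriv v f (x + t *\<^sub>R v)) (at 0)"
      using diff[OF that, of "x + t *\<^sub>R v"] unfolding partial_deriv_def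
      by (simp add: DERIV_deriv_iff_real_differentiable)
    then show ?thesis
      using DERIV_shift[of "\<lambda>t. f (x + t *\<^sub>R v)" _ 0 t] by (simp add: algebra_simps)
  qed
  have zero: "partial_deriv v f x = 0" if "x \<notin> K" for v x
  proof -
    have "open (- K)" by (simp add: K_def open_Compl)
    then have "open ((\<lambda>t. x + t *\<^sub>R v) -` (- K))"
      by (rule open_vimage) (intro continuous_intros)
    moreover have "0 \<in> (\<lambda>t. x + t *\<^sub>R v) -` (- K)" using that by simp
    ultimately have "eventually (\<lambda>t. t \<in> (\<lambda>t. x + t *\<^sub>R v) -` (- K)) (nhds 0)"
      by (rule eventually_nhds_in_open)
    then have "eventually (\<lambda>t. f (x + t *\<^sub>R v) = 0) (nhds 0)"
      by eventually_elim (use closure_subset[of "{x. f x \<noteq> 0}"] in \<open>auto simp: K_def\<close>)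
    then have "((\<lambda>t. f (x + t *\<^sub>R v)) has_real_derivative 0) (at 0)"
      by (subst DERIV_cong_ev[OF refl _ refl]) auto
    then show ?thesis unfolding partial_deriv_def by (rule DERIV_imp_deriv)
  qed
  have "\<exists>B. \<forall>x. \<bar>partial_deriv v f x\<bar> \<le> B" if "v \<in> Basis" for v
  proof -
    have "continuous_on UNIV (partial_deriv v f)"
      using sm that unfolding smooth_fun_def by (auto dest!: spec[of _ "[v]"])
    then have "compact (partial_deriv v f ` K)"
      using K continuous_on_subset by (intro compact_continuous_image) auto
    then obtain B where "\<forall>x\<in>K. \<bar>partial_deriv v f x\<bar> \<le> B"
      using compact_imp_bounded[of "partial_deriv v f ` K"] by (auto simp: bounded_iff)
    then have "\<bar>partial_deriv v f x\<bar> \<le> max B 0" for x using zero[of x v] by (cases "x \<in> K") force+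
    then show ?thesis by blast
  qed
  then obtain B where B: "\<And>v x. v \<in> Basis \<Longrightarrow> \<bar>partial_deriv v f x\<bar> \<le> B v" by metis
  have step: "\<bar>f (x + t *\<^sub>R v) - f x\<bar> \<le> B v * \<bar>t\<bar>" if "v \<in> Basis" for x v t
    using field_differentiable_bound[of UNIV "\<lambda>t. f (x + t *\<^sub>R v)" "\<lambda>t. partial_deriv v f (x + t *\<^sub>R v)" "B v" t 0]
      der[OF that, of x] B[OF that] by simp
  have tel: "\<bar>f (x + (\<Sum>b\<in>A. c b *\<^sub>R b)) - f x\<bar> \<le> (\<Sum>b\<in>A. B b * \<bar>c b\<bar>)" if "finite A" "A \<subseteq> Basis" for A x c
    using that
  proof (induction A arbitrary: x rule: finite_induct)
    case (insert b A)
    have "\<bar>f (x + (\<Sum>b\<in>insert b A. c b *\<^sub>R b)) - f x\<bar>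
        \<le> \<bar>f ((x + c b *\<^sub>R b) + (\<Sum>b\<in>A. c b *\<^sub>R b)) - f (x + c b *\<^sub>R b)\<bar> + \<bar>f (x + c b *\<^sub>R b) - f x\<bar>"
      using insert.hyps by (simp add: add.assoc)
    also have "\<dots> \<le> (\<Sum>b\<in>A. B b * \<bar>c b\<bar>) + B b * \<bar>c b\<bar>"
      using insert by (intro add_mono insert.IH step) auto
    finally show ?case using insert by simp
  qed simp
  have B0: "0 \<le> B v" if "v \<in> Basis" for v using B[OF that] by (meson abs_ge_zero order_trans)
  have "\<bar>f x - f y\<bar> \<le> (\<Sum>b\<in>Basis. B b) * norm (x - y)" for x y
  proof -
    have "\<bar>f (y + (\<Sum>b\<in>Basis. ((x - y) \<bullet> b) *\<^sub>R b)) - f y\<bar> \<le> (\<Sum>b\<in>Basis. B b * \<bar>(x - y) \<bullet> b\<bar>)"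
      by (rule tel) auto
    also have "\<dots> \<le> (\<Sum>b\<in>Basis. B b * norm (x - y))"
      by (intro sum_mono mult_left_mono Basis_le_norm B0)
    finally show ?thesis by (simp add: euclidean_representation sum_distrib_right)
  qed
  moreover obtain R where R: "\<And>x. x \<in> K \<Longrightarrow> norm x \<le> R"
    using compact_imp_bounded[OF K] by (auto simp: bounded_iff)
  moreover have "f x = 0" if "R + 1 \<le> norm x" for x
    using R[of x] that closure_subset[of "{x. f x \<noteq> 0}"] by (force simp: K_def)
  ultimately show ?thesis
    using lipschitz_compact_support_in_Wsp[OF sp, of f] by blast
qed

section \<open>Smooth bumps and convolution\<close>

text \<open>For Q = 1 and m = 0 this is the standard bump exp (-1 / (1 - t^2)). The parameters make
  the family closed under differentiation.\<close>

definition bump_poly :: "real poly \<Rightarrow> nat \<Rightarrow> real \<Rightarrow> real" where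
  "bump_poly Q m t = (if \<bar>t\<bar> < 1 then poly Q t / (1 - t\<^sup>2) ^ m * exp (- (1 / (1 - t\<^sup>2))) else 0)"

text \<open>The exponential beats every power of w = 1 - t^2. The square on the right is the order
  of vanishing that makes the derivative at the end points zero.\<close>

lemma bump_poly_flat:
  "\<exists>C. \<forall>t. \<bar>t\<bar> < 1 \<longrightarrow> \<bar>bump_poly Q m t\<bar> \<le> C * (1 - t\<^sup>2)\<^sup>2"
proof -
  have "compact (poly Q ` {-1..1})"
    by (intro compact_continuous_image continuous_intros) auto
  then have "\<exists>B. \<forall>t\<in>{-1..1}. \<bar>poly Q t\<bar> \<le> B"
    using compact_imp_bounded[of "poly Q ` {-1..1}"] by (simp add: bounded_iff)
  then obtain B where B: "\<And>t. t \<in> {-1..1} \<Longrightarrow> \<bar>poly Q t\<bar> \<le> B" by blast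
  have "\<bar>bump_poly Q m t\<bar> \<le> (B * fact (m + 2)) * (1 - t\<^sup>2)\<^sup>2" if t: "\<bar>t\<bar> < 1" for t
  proof -
    define w where "w = 1 - t\<^sup>2"
    have w: "w > 0" using t by (simp add: w_def abs_square_less_1)
    \<comment> \<open>A single term of the exponential series gives exp (-1/w) <= k! w^k; the choice
      k = m + 2 absorbs the denominator w^m and leaves w^2.\<close>
    have "inverse (fact k) * (1 / w) ^ k \<le> exp (1 / w)" for k
      using w sum_le_suminf[OF summable_exp_generic, of "{k}" "1 / w"] by (simp add: exp_def)
    then have "inverse (exp (1 / w)) \<le> inverse (inverse (fact k) * (1 / w) ^ k)" for k
      using w by (intro le_imp_inverse_le) auto
    then have "exp (- (1 / w)) \<le> fact k * w ^ k" for k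
      by (simp add: exp_minus power_inverse divide_inverse mult.commute)
    then have "exp (- (1 / w)) \<le> fact (m + 2) * (w\<^sup>2 * w ^ m)"
      by (metis power_add add.commute)
    then have le: "exp (- (1 / w)) / w ^ m \<le> fact (m + 2) * w\<^sup>2"
      using w by (simp add: pos_divide_le_eq mult.assoc del: fact_Suc)
    have B': "\<bar>poly Q t\<bar> \<le> B" using t by (intro B) auto
    have "\<bar>bump_poly Q m t\<bar> = \<bar>poly Q t\<bar> * (exp (- (1 / w)) / w ^ m)"
      using t w by (simp add: bump_poly_def w_def[symmetric] abs_mult)
    also have "\<dots> \<le> B * (fact (m + 2) * w\<^sup>2)"
      using w order.trans[OF abs_ge_zero B'] by (intro mult_mono le B') auto
    finally have "\<bar>bump_poly Q m t\<bar> \<le> B * (fact (m + 2) * w\<^sup>2)" .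
    then show ?thesis by (simp add: w_def mult.assoc)
  qed
  then show ?thesis by blast
qed

text \<open>With \<open>w = 1 - t\<^sup>2\<close>, the derivative of \<open>Q / w^m * exp (- 1/w)\<close> is
  \<open>(Q' w\<^sup>2 + 2 m t Q w - 2 t Q) / w^(m + 2) * exp (- 1/w)\<close>.\<close>

definition bump_dpoly :: "real poly \<Rightarrow> nat \<Rightarrow> real poly" where
  "bump_dpoly Q m = pderiv Q * [:1, 0, -1:] ^ 2 + smult (2 * real m) ([:0, 1:] * Q * [:1, 0, -1:])
     - smult 2 ([:0, 1:] * Q)"

lemma has_real_derivative_bump_poly:
  "(bump_poly Q m has_real_derivative bump_poly (bump_dpoly Q m) (m + 2) t) (at t)"
proof (cases "\<bar>t\<bar> < 1")
  case True
  define w where "w = 1 - t\<^sup>2"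
  have w: "w > 0" using True by (simp add: w_def abs_square_less_1)
  have dw: "((\<lambda>t. 1 - t\<^sup>2) has_real_derivative - (2 * t)) (at t)"
    by (auto intro!: derivative_eq_intros)
  have de: "((\<lambda>t. exp (- (1 / (1 - t\<^sup>2)))) has_real_derivative exp (- (1 / w)) * (- (2 * t / w\<^sup>2))) (at t)"
    unfolding w_def by (rule DERIV_chain2[OF DERIV_exp])
      (rule derivative_eq_intros refl dw | use w in \<open>simp add: w_def power2_eq_square\<close>)+
  have dp: "((\<lambda>t. poly Q t / (1 - t\<^sup>2) ^ m) has_real_derivative
      (poly (pderiv Q) t * w ^ m - poly Q t * (real m * w ^ (m - 1) * - (2 * t))) / (w ^ m * w ^ m)) (at t)"
    unfolding w_def
    by (rule derivative_eq_intros poly_DERIV dw refl | use w in \<open>simp add: w_def\<close>)+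
  have eq: "(poly (pderiv Q) t * w ^ m - poly Q t * (real m * w ^ (m - 1) * - (2 * t))) / (w ^ m * w ^ m)
        * exp (- (1 / w)) + exp (- (1 / w)) * (- (2 * t / w\<^sup>2)) * (poly Q t / w ^ m)
      = bump_poly (bump_dpoly Q m) (m + 2) t"
  proof -
    \<comment> \<open>For m = 0 the truncated subtraction is harmless, since the factor m is
      zero.\<close>
    have wm: "real m * w ^ (m - 1) = real m * w ^ m / w" using w by (cases m) auto
    have pw: "poly (bump_dpoly Q m) t = poly (pderiv Q) t * w\<^sup>2 + 2 * real m * t * poly Q t * w - 2 * t * poly Q t"
      by (simp add: bump_dpoly_def w_def power2_eq_square algebra_simps)
    define A where "A = w ^ m"
    have A: "A > 0" using w by (simp add: A_def)
    have b: "bump_poly (bump_dpoly Q m) (m + 2) t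
        = (poly (pderiv Q) t * w\<^sup>2 + 2 * real m * t * poly Q t * w - 2 * t * poly Q t) / (A * w\<^sup>2) * exp (- (1 / w))"
      using True unfolding bump_poly_def pw w_def[symmetric] by (simp add: A_def power_add power2_eq_square)
    show ?thesis
      unfolding wm b A_def[symmetric] using A w
      by (simp add: divide_simps power2_eq_square) (simp add: algebra_simps)
  qed
  have "((\<lambda>t. poly Q t / (1 - t\<^sup>2) ^ m * exp (- (1 / (1 - t\<^sup>2)))) has_real_derivative
      bump_poly (bump_dpoly Q m) (m + 2) t) (at t)"
    using DERIV_mult[OF dp de] unfolding w_def[symmetric] eq .
  then show ?thesis
    by (rule DERIV_cong_ev[THEN iffD1, rotated -1])
       (use True eventually_nhds_in_open[of "{-1<..<1}" t] in
         \<open>auto elim!: eventually_mono simp: bump_poly_def abs_less_iff\<close>)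
next
  case False
  obtain C where C: "\<And>t. \<bar>t\<bar> < 1 \<Longrightarrow> \<bar>bump_poly Q m t\<bar> \<le> C * (1 - t\<^sup>2)\<^sup>2"
    using bump_poly_flat by blast
  \<comment> \<open>As |t| >= 1, the point t + h lies within |h| of the end of the interval when it
    is inside, so 1 - (t + h)^2 is at most 2 |h|. Flatness then makes the difference quotient of
    order |h|.\<close>
  have bound: "\<bar>bump_poly Q m (t + h)\<bar> \<le> \<bar>C\<bar> * (4 * h\<^sup>2)" for h
  proof (cases "\<bar>t + h\<bar> < 1")
    case True
    define u where "u = t + h"
    have "1 - u\<^sup>2 = (1 - \<bar>u\<bar>) * (1 + \<bar>u\<bar>)" by (simp add: algebra_simps power2_eq_square)
    also have "\<dots> \<le> \<bar>h\<bar> * 2" using True False by (intro mult_mono) (auto simp: u_def)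
    finally have "1 - u\<^sup>2 \<le> \<bar>2 * h\<bar>" by simp
    moreover have "0 \<le> 1 - u\<^sup>2" using True by (simp add: u_def abs_square_le_1)
    ultimately have "(1 - u\<^sup>2)\<^sup>2 \<le> \<bar>2 * h\<bar>\<^sup>2" by (intro power_mono)
    then have "(1 - u\<^sup>2)\<^sup>2 \<le> 4 * h\<^sup>2" by (simp add: power_mult_distrib)
    then have "\<bar>C\<bar> * (1 - u\<^sup>2)\<^sup>2 \<le> \<bar>C\<bar> * (4 * h\<^sup>2)" by (intro mult_left_mono) auto
    moreover have "C * (1 - u\<^sup>2)\<^sup>2 \<le> \<bar>C\<bar> * (1 - u\<^sup>2)\<^sup>2" by (intro mult_right_mono) auto
    ultimately show ?thesis using C[OF True] by (simp add: u_def)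
  qed (simp add: bump_poly_def)
  have "((\<lambda>h. bump_poly Q m (t + h) / h) \<longlongrightarrow> 0) (at 0)"
  proof (rule Lim_null_comparison)
    show "eventually (\<lambda>h. norm (bump_poly Q m (t + h) / h) \<le> \<bar>C\<bar> * (4 * \<bar>h\<bar>)) (at 0)"
      unfolding eventually_at_filter
    proof (intro always_eventually allI impI)
      fix h :: real assume "h \<noteq> 0"
      then show "norm (bump_poly Q m (t + h) / h) \<le> \<bar>C\<bar> * (4 * \<bar>h\<bar>)"
        using bound[of h] by (simp add: abs_divide divide_le_eq power2_eq_square mult.assoc flip: abs_mult)
    qed
    show "((\<lambda>h. \<bar>C\<bar> * (4 * \<bar>h\<bar>)) \<longlongrightarrow> 0) (at 0)"
      by (auto intro!: tendsto_eq_intros)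
  qed
  then show ?thesis using False by (simp add: DERIV_def bump_poly_def)
qed

text \<open>One support radius is fixed for the whole class; polynomial and exponent vary because
  differentiation changes them.\<close>

definition bump_class :: "real \<Rightarrow> (real \<Rightarrow> real) set" where
  "bump_class r = {g. \<exists>Q m. g = (\<lambda>t. bump_poly Q m (t / r))}"

lemma bump_class_deriv:
  assumes "g \<in> bump_class r"
  shows "\<exists>g'\<in>bump_class r. \<forall>t. (g has_real_derivative g' t) (at t)"
proof -
  obtain Q m where g: "g = (\<lambda>t. bump_poly Q m (t / r))" using assms by (auto simp: bump_class_def)
  let ?g = "\<lambda>t. bump_poly (smult (1 / r) (bump_dpoly Q m)) (m + 2) (t / r)"
  have "(g has_real_derivative ?g t) (at t)" for t
  proof -
    have "((\<lambda>t. bump_poly Q m (t / r)) has_real_derivative bump_poly (bump_dpoly Q m) (m + 2) (t / r) * (1 / r)) (at t)"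
      by (rule DERIV_chain2[OF has_real_derivative_bump_poly DERIV_cdivide[OF DERIV_ident]])
    then show ?thesis unfolding g by (rule DERIV_cong) (simp add: bump_poly_def)
  qed
  then show ?thesis by (intro bexI[of _ ?g]) (auto simp: bump_class_def)
qed

lemma bump_class_continuous:
  assumes "g \<in> bump_class r" shows "continuous_on S g"
  using bump_class_deriv[OF assms] DERIV_continuous_on[of S g] has_field_derivative_at_within by metis

lemma bump_class_eq_0: "g \<in> bump_class r \<Longrightarrow> 0 < r \<Longrightarrow> r \<le> \<bar>t\<bar> \<Longrightarrow> g t = 0"
  by (auto simp: bump_class_def bump_poly_def abs_divide)

text \<open>Convolution with a product kernel. Each coordinate has its own profile, so that a
  partial derivative merely replaces one of them, and the fixed box permits differentiation under
  the integral.\<close>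

definition bump_conv ::
  "'a \<Rightarrow> 'a \<Rightarrow> ('a \<Rightarrow> real) \<Rightarrow> ('a \<Rightarrow> real \<Rightarrow> real) \<Rightarrow> 'a::euclidean_space \<Rightarrow> real" where
  "bump_conv a b f G x = integral (cbox a b) (\<lambda>y. f y * (\<Prod>i\<in>Basis. G i ((x - y) \<bullet> i)))"

lemma continuous_on_bump_prod:
  fixes f :: "'a::euclidean_space \<Rightarrow> real" and X :: "'b::topological_space \<Rightarrow> 'a"
  assumes "continuous_on UNIV f" "\<And>i. i \<in> Basis \<Longrightarrow> G i \<in> bump_class r"
    "continuous_on S X" "continuous_on S Y"
  shows "continuous_on S (\<lambda>z. f (Y z) * (\<Prod>i\<in>Basis. G i ((X z - Y z) \<bullet> i)))"
proof (intro continuous_on_mult continuous_on_prod)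
  show "continuous_on S (\<lambda>z. f (Y z))" using continuous_on_compose2[OF assms(1,4)] by simp
  fix i :: 'a assume "i \<in> Basis"
  then show "continuous_on S (\<lambda>z. G i ((X z - Y z) \<bullet> i))"
    using assms by (intro continuous_on_compose2[OF bump_class_continuous[of "G i" r UNIV]] continuous_intros) auto
qed

lemma continuous_on_bump_conv:
  assumes "continuous_on UNIV f" "\<And>i. i \<in> Basis \<Longrightarrow> G i \<in> bump_class r"
  shows "continuous_on UNIV (bump_conv a b f G)"
  unfolding bump_conv_def[abs_def]
  by (intro integral_continuous_on_param)
     (unfold split_beta, intro continuous_on_bump_prod[OF assms] continuous_intros)

text \<open>Moving along v affects only the factor belonging to v. Its derivative is jointly
  continuous in t and y, so the Leibniz rule applies on the compact box.\<close>

lemma has_real_derivative_bump_conv: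
  fixes f :: "'a::euclidean_space \<Rightarrow> real"
  assumes f: "continuous_on UNIV f" and G: "\<And>i. i \<in> Basis \<Longrightarrow> G i \<in> bump_class r"
    and v: "v \<in> Basis" and g': "g' \<in> bump_class r" "\<And>t. (G v has_real_derivative g' t) (at t)"
  shows "((\<lambda>t. bump_conv a b f G (x + t *\<^sub>R v)) has_real_derivative bump_conv a b f (G(v := g')) x) (at 0)"
proof -
  have split: "(\<Prod>i\<in>Basis. H i ((x + t *\<^sub>R v - y) \<bullet> i))
      = H v ((x - y) \<bullet> v + t) * (\<Prod>i\<in>Basis - {v}. H i ((x - y) \<bullet> i))" for H t y
  proof -
    have "(\<Prod>i\<in>Basis. H i ((x + t *\<^sub>R v - y) \<bullet> i))
        = H v ((x + t *\<^sub>R v - y) \<bullet> v) * (\<Prod>i\<in>Basis - {v}. H i ((x + t *\<^sub>R v - y) \<bullet> i))"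
      using v by (intro prod.remove) auto
    also have "(x + t *\<^sub>R v - y) \<bullet> v = (x - y) \<bullet> v + t"
      using v by (simp add: inner_add_left inner_diff_left inner_Basis)
    also have "(\<Prod>i\<in>Basis - {v}. H i ((x + t *\<^sub>R v - y) \<bullet> i)) = (\<Prod>i\<in>Basis - {v}. H i ((x - y) \<bullet> i))"
      using v by (intro prod.cong) (auto simp: inner_add_left inner_diff_left inner_Basis)
    finally show ?thesis .
  qed
  have G': "(G(v := g')) i \<in> bump_class r" if "i \<in> Basis" for i using G g' that by auto
  have "((\<lambda>t. integral (cbox a b) (\<lambda>y. f y * (\<Prod>i\<in>Basis. G i ((x + t *\<^sub>R v - y) \<bullet> i)))) has_real_derivative
      integral (cbox a b) (\<lambda>y. f y * (\<Prod>i\<in>Basis. (G(v := g')) i ((x + 0 *\<^sub>R v - y) \<bullet> i)))) (at 0 within UNIV)"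
  proof (rule leibniz_rule_field_derivative)
    fix t y
    have "((\<lambda>t. G v ((x - y) \<bullet> v + t)) has_real_derivative g' ((x - y) \<bullet> v + t)) (at t)"
      using DERIV_shift[of "G v" "g' ((x - y) \<bullet> v + t)" t "(x - y) \<bullet> v"] g'(2)[of "(x - y) \<bullet> v + t"] by (simp add: add.commute)
    then have "((\<lambda>t. f y * (G v ((x - y) \<bullet> v + t) * (\<Prod>i\<in>Basis - {v}. G i ((x - y) \<bullet> i)))) has_real_derivative
        f y * (g' ((x - y) \<bullet> v + t) * (\<Prod>i\<in>Basis - {v}. G i ((x - y) \<bullet> i)))) (at t)"
      by (intro DERIV_cmult DERIV_cmult_right)
    moreover have "(\<Prod>i\<in>Basis - {v}. (G(v := g')) i ((x - y) \<bullet> i)) = (\<Prod>i\<in>Basis - {v}. G i ((x - y) \<bullet> i))"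
      by (intro prod.cong) auto
    ultimately show "((\<lambda>t. f y * (\<Prod>i\<in>Basis. G i ((x + t *\<^sub>R v - y) \<bullet> i))) has_real_derivative
        f y * (\<Prod>i\<in>Basis. (G(v := g')) i ((x + t *\<^sub>R v - y) \<bullet> i))) (at t within UNIV)"
      unfolding split by simp
  next
    fix t
    show "(\<lambda>y. f y * (\<Prod>i\<in>Basis. G i ((x + t *\<^sub>R v - y) \<bullet> i))) integrable_on cbox a b"
      by (intro integrable_continuous continuous_on_bump_prod[OF f G] continuous_intros) auto
  next
    show "continuous_on (UNIV \<times> cbox a b) (\<lambda>(t, y). f y * (\<Prod>i\<in>Basis. (G(v := g')) i ((x + t *\<^sub>R v - y) \<bullet> i)))"
      unfolding split_beta by (intro continuous_on_bump_prod[OF f G'] continuous_intros) auto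
  qed auto
  then show ?thesis by (simp add: bump_conv_def)
qed

text \<open>Every iterated partial derivative is again a convolution of f, with other profiles;
  continuity and differentiability therefore only have to be known for the class as a whole.\<close>

lemma smooth_fun_bump_conv:
  fixes f :: "'a::euclidean_space \<Rightarrow> real"
  assumes f: "continuous_on UNIV f" and G: "\<And>i. i \<in> Basis \<Longrightarrow> G i \<in> bump_class r"
  shows "smooth_fun (bump_conv a b f G)"
proof -
  have ex: "\<exists>H. (\<forall>i\<in>Basis. H i \<in> bump_class r) \<and> foldr partial_deriv vs (bump_conv a b f G) = bump_conv a b f H"
    if "set vs \<subseteq> Basis" for vs
    using that
  proof (induction vs)
    case Nil then show ?case using G by auto
  next
    case (Cons v vs)
    then obtain H where H: "\<And>i. i \<in> Basis \<Longrightarrow> H i \<in> bump_class r"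
      "foldr partial_deriv vs (bump_conv a b f G) = bump_conv a b f H" by auto
    have v: "v \<in> Basis" using Cons by simp
    obtain g' where g': "g' \<in> bump_class r" "\<And>t. (H v has_real_derivative g' t) (at t)"
      using bump_class_deriv[OF H(1)[OF v]] by blast
    have "partial_deriv v (bump_conv a b f H) = bump_conv a b f (H(v := g'))"
      unfolding partial_deriv_def[abs_def]
      by (rule ext) (rule DERIV_imp_deriv[OF has_real_derivative_bump_conv[where G = H, OF f H(1) v g']])
    then have "foldr partial_deriv (v # vs) (bump_conv a b f G) = bump_conv a b f (H(v := g'))"
      using H(2) by simp
    moreover have "\<forall>i\<in>Basis. (H(v := g')) i \<in> bump_class r" using H(1) g'(1) by simp
    ultimately show ?case by blast
  qed
  show ?thesis
    unfolding smooth_fun_def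
  proof (intro allI impI conjI ballI)
    fix vs assume "set vs \<subseteq> (Basis :: 'a set)"
    then obtain H where H: "\<And>i. i \<in> Basis \<Longrightarrow> H i \<in> bump_class r"
      "foldr partial_deriv vs (bump_conv a b f G) = bump_conv a b f H" using ex by blast
    show "continuous_on UNIV (foldr partial_deriv vs (bump_conv a b f G))"
      unfolding H(2) by (rule continuous_on_bump_conv[OF f H(1)])
    fix v x assume v: "v \<in> (Basis :: 'a set)"
    obtain g' where g': "g' \<in> bump_class r" "\<And>t. (H v has_real_derivative g' t) (at t)"
      using bump_class_deriv[OF H(1)[OF v]] by blast
    show "(\<lambda>t. foldr partial_deriv vs (bump_conv a b f G) (x + t *\<^sub>R v)) differentiable (at 0)"
      unfolding H(2) using has_real_derivative_bump_conv[where G = H, OF f H(1) v g'] real_differentiable_def by blast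
  qed
qed

section \<open>Mollification\<close>

lemma integral_lborel_reflect:
  fixes h :: "'a::euclidean_space \<Rightarrow> real"
  assumes [measurable]: "h \<in> borel_measurable borel"
  shows "(\<integral>y. h (x - y) \<partial>lborel) = (\<integral>y. h y \<partial>lborel)"
proof -
  have "lborel = distr lborel borel (\<lambda>y. x - y)"
    using lborel_affine[of "-1" x] by (simp add: density_1)
  then have "(\<integral>y. h y \<partial>lborel) = (\<integral>y. h y \<partial>distr lborel borel (\<lambda>y. x - y))" by simp
  also have "\<dots> = (\<integral>y. h (x - y) \<partial>lborel)" by (rule integral_distr) measurable
  finally show ?thesis ..
qed

lemma integrable_continuous_compact_support:
  fixes h :: "'a::euclidean_space \<Rightarrow> real"
  assumes "continuous_on UNIV h" "\<And>x. x \<notin> cbox a b \<Longrightarrow> h x = 0"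
  shows "integrable lborel h"
proof -
  have "integrable lborel (\<lambda>x. indicator (cbox a b) x *\<^sub>R h x)"
    using assms(1) by (intro borel_integrable_compact) (auto intro: continuous_on_subset)
  moreover have "(\<lambda>x. indicator (cbox a b) x *\<^sub>R h x) = h"
    using assms(2) by (intro ext) (auto split: split_indicator)
  ultimately show ?thesis by simp
qed

lemma lborel_integral_compact_support:
  fixes h :: "'a::euclidean_space \<Rightarrow> real"
  assumes "continuous_on UNIV h" "\<And>x. x \<notin> cbox a b \<Longrightarrow> h x = 0"
  shows "(\<integral>x. h x \<partial>lborel) = integral (cbox a b) h"
proof -
  have "(\<lambda>x. if x \<in> cbox a b then h x else 0) = h" using assms(2) by auto
  then have "integral UNIV h = integral (cbox a b) h"
    using integral_restrict_UNIV[of "cbox a b" h] by simp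
  then show ?thesis
    using integral_lborel[OF integrable_continuous_compact_support[OF assms]] by simp
qed

text \<open>Jensen's inequality: integrate the subgradient inequality at the mean value.\<close>

lemma abs_powr_integral_le:
  fixes d k :: "'a::euclidean_space \<Rightarrow> real"
  assumes p: "1 < p" and "\<And>z. 0 \<le> k z" "integrable lborel k" "(\<integral>z. k z \<partial>lborel) = 1"
    "integrable lborel (\<lambda>z. k z * d z)" "integrable lborel (\<lambda>z. k z * \<bar>d z\<bar> powr p)"
  shows "\<bar>\<integral>z. k z * d z \<partial>lborel\<bar> powr p \<le> (\<integral>z. k z * \<bar>d z\<bar> powr p \<partial>lborel)"
proof -
  define D where "D = (\<integral>z. k z * d z \<partial>lborel)"
  have "\<bar>D\<bar> powr p = (\<integral>z. (\<bar>D\<bar> powr p - p * Jp p D * D) * k z + p * Jp p D * (k z * d z) \<partial>lborel)"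
    using assms(3-5) by (simp add: D_def[symmetric])
  also have "\<dots> \<le> (\<integral>z. k z * \<bar>d z\<bar> powr p \<partial>lborel)"
  proof (rule integral_mono)
    fix z
    have "k z * (\<bar>D\<bar> powr p + p * Jp p D * (d z - D)) \<le> k z * \<bar>d z\<bar> powr p"
      by (intro mult_left_mono abs_powr_subgradient[OF p] assms(2))
    then show "(\<bar>D\<bar> powr p - p * Jp p D * D) * k z + p * Jp p D * (k z * d z) \<le> k z * \<bar>d z\<bar> powr p"
      by (simp add: algebra_simps)
  qed (use assms(3,5,6) in auto)
  finally show ?thesis by (simp add: D_def)
qed

text \<open>Increments of g are weighted means of increments of translates of f, so Jensen's
  inequality holds pair by pair. Exchanging the integrals leaves the energy of each translate, which
  is that of f, times the total mass one.\<close>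

lemma gagliardo_enn_convolution_le:
  fixes f k g :: "'a::euclidean_space \<Rightarrow> real"
  assumes p: "1 < p" and f: "continuous_on UNIV f" and k: "continuous_on UNIV k" "\<And>z. 0 \<le> k z"
    and supp: "\<And>z. z \<notin> cbox a b \<Longrightarrow> k z = 0" and one: "(\<integral>z. k z \<partial>lborel) = 1"
    and g: "\<And>x. g x = (\<integral>z. k z * f (x - z) \<partial>lborel)"
  shows "gagliardo_enn s p g \<le> gagliardo_enn s p f"
proof -
  have [measurable]: "f \<in> borel_measurable borel" "k \<in> borel_measurable borel"
    using f k by (auto intro: borel_measurable_continuous_onI)
  have cf: "continuous_on UNIV (\<lambda>z. f (x - z))" for x
    by (rule continuous_on_compose2[OF f]) (auto intro!: continuous_intros)
  have i1: "integrable lborel (\<lambda>z. k z * f (x - z))" for x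
    by (rule integrable_continuous_compact_support[of _ a b])
       (use supp in \<open>auto intro!: continuous_on_mult k cf\<close>)
  have ik: "integrable lborel k"
    using integrable_continuous_compact_support[OF k(1) supp] .
  have "\<bar>g x - g y\<bar> powr p \<le> (\<integral>z. k z * \<bar>f (x - z) - f (y - z)\<bar> powr p \<partial>lborel)
      \<and> integrable lborel (\<lambda>z. k z * \<bar>f (x - z) - f (y - z)\<bar> powr p)" for x y
  proof -
    have i2: "integrable lborel (\<lambda>z. k z * \<bar>f (x - z) - f (y - z)\<bar> powr p)"
    proof (rule integrable_continuous_compact_support[of _ a b])
      show "continuous_on UNIV (\<lambda>z. k z * \<bar>f (x - z) - f (y - z)\<bar> powr p)"
        using p by (intro continuous_on_mult k(1) continuous_on_powr' continuous_on_rabs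
            continuous_on_diff cf continuous_on_const) auto
    qed (simp add: supp)
    have "g x - g y = (\<integral>z. k z * (f (x - z) - f (y - z)) \<partial>lborel)"
      using i1[of x] i1[of y] by (simp add: g right_diff_distrib)
    then show ?thesis
      using abs_powr_integral_le[OF p k(2) ik one _ i2] i1[of x] i1[of y] i2 by (simp add: right_diff_distrib)
  qed
  note jensen = this
  have pw: "ennreal (gdens s p g w) \<le>
      (\<integral>\<^sup>+z. ennreal (k z) * ennreal (gdens s p (\<lambda>x. f (- z + x)) w) \<partial>lborel)" for w
  proof -
    define n where "n = norm (fst w - snd w) powr (real DIM('a) + s * p)"
    have n: "0 \<le> n" by (simp add: n_def)
    note J = jensen[of "fst w" "snd w"]
    have "gdens s p g w \<le> (\<integral>z. k z * \<bar>f (fst w - z) - f (snd w - z)\<bar> powr p \<partial>lborel) / n"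
      unfolding gdens_def n_def[symmetric] using J n by (intro divide_right_mono) auto
    also have "\<dots> = (\<integral>z. k z * \<bar>f (fst w - z) - f (snd w - z)\<bar> powr p / n \<partial>lborel)" by simp
    finally have "ennreal (gdens s p g w) \<le> ennreal (\<integral>z. k z * \<bar>f (fst w - z) - f (snd w - z)\<bar> powr p / n \<partial>lborel)"
      by (rule ennreal_leI)
    also have "\<dots> = (\<integral>\<^sup>+z. ennreal (k z * \<bar>f (fst w - z) - f (snd w - z)\<bar> powr p / n) \<partial>lborel)"
      using J k(2) n by (intro nn_integral_eq_integral[symmetric]) auto
    also have "\<dots> = (\<integral>\<^sup>+z. ennreal (k z) * ennreal (gdens s p (\<lambda>x. f (- z + x)) w) \<partial>lborel)"
      using k(2) by (intro nn_integral_cong) (simp add: gdens_def n_def flip: ennreal_mult)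
    finally show ?thesis .
  qed
  have E: "(\<integral>\<^sup>+w. ennreal (gdens s p (\<lambda>x. f (- z + x)) w) \<partial>lborel) = gagliardo_enn s p f" for z
    using gagliardo_enn_similarity[OF _ similarity_translate[of "- z"], of f s p]
    by (simp add: gagliardo_enn_gdens lborel_prod)
  have m: "(\<lambda>w. gdens s p (\<lambda>x. f (- z + x)) w) \<in> borel_measurable borel" for z
    using borel_measurable_gdens[of "\<lambda>x. f (- z + x)" s p] by (simp add: lborel_prod)
  have "gagliardo_enn s p g = (\<integral>\<^sup>+w. ennreal (gdens s p g w) \<partial>lborel)"
    by (simp add: gagliardo_enn_gdens lborel_prod)
  also have "\<dots> \<le> (\<integral>\<^sup>+w. \<integral>\<^sup>+z. ennreal (k z) * ennreal (gdens s p (\<lambda>x. f (- z + x)) w) \<partial>lborel \<partial>lborel)"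
    by (intro nn_integral_mono pw)
  also have "\<dots> = (\<integral>\<^sup>+z. \<integral>\<^sup>+w. ennreal (k z) * ennreal (gdens s p (\<lambda>x. f (- z + x)) w) \<partial>lborel \<partial>lborel)"
  proof (rule lborel_pair.Fubini')
    show "(\<lambda>(z, w). ennreal (k z) * ennreal (gdens s p (\<lambda>x. f (- z + x)) w))
        \<in> borel_measurable (lborel \<Otimes>\<^sub>M (lborel :: ('a \<times> 'a) measure))"
      unfolding gdens_def lborel_prod[symmetric] by measurable
  qed
  also have "\<dots> = (\<integral>\<^sup>+z. ennreal (k z) * gagliardo_enn s p f \<partial>lborel)"
  proof (rule nn_integral_cong)
    fix z
    show "(\<integral>\<^sup>+w. ennreal (k z) * ennreal (gdens s p (\<lambda>x. f (- z + x)) w) \<partial>lborel)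
        = ennreal (k z) * gagliardo_enn s p f"
      unfolding E[of z, symmetric] by (rule nn_integral_cmult) (use m[of z] in simp)
  qed
  also have "\<dots> = gagliardo_enn s p f"
    using nn_integral_eq_integral[OF ik] k(2) one by (simp add: nn_integral_multc)
  finally show ?thesis .
qed

lemma mollify:
  fixes f :: "'a::euclidean_space \<Rightarrow> real"
  assumes sp: "0 < s" "s < 1" "1 < p" "s * p > real DIM('a)"
    and f: "f \<in> Wsp s p" and supp: "\<And>x. R \<le> norm x \<Longrightarrow> f x = 0" and e: "0 < e"
  shows "\<exists>g. test_fun g \<and> (\<forall>x. \<bar>g x - f x\<bar> \<le> e) \<and> gagliardo_enn s p g \<le> gagliardo_enn s p f"
proof -
  let ?\<alpha> = "alpha_sp s p DIM('a)"
  note \<alpha> = alpha_sp_bounds(1)[OF sp]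
  note cont = WspD(1)[OF f]
  obtain C where C: "0 \<le> C" "\<And>x y. \<bar>f x - f y\<bar> \<le> C * norm (x - y) powr ?\<alpha>"
    using holder_boundedE[OF WspD(2)[OF f]] by blast
  \<comment> \<open>If all coordinates of z are below r, the sum of their moduli, and hence |z|, is
    at most (e / (C + 1))^(1/\<alpha>), where the Hoelder bound is at most e. Using C + 1 avoids
    division by zero.\<close>
  define r where "r = (e / (C + 1)) powr (1 / ?\<alpha>) / real DIM('a)"
  have r: "0 < r" using e C by (simp add: r_def)
  have small: "\<bar>f (x - z) - f x\<bar> \<le> e" if z: "\<And>i. i \<in> Basis \<Longrightarrow> \<bar>z \<bullet> i\<bar> < r" for x z
  proof -
    have "norm z \<le> (\<Sum>i\<in>Basis. \<bar>z \<bullet> i\<bar>)" by (rule norm_le_l1)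
    also have "\<dots> \<le> (\<Sum>i\<in>(Basis::'a set). r)" by (intro sum_mono less_imp_le z)
    finally have "norm z \<le> (e / (C + 1)) powr (1 / ?\<alpha>)" by (simp add: r_def)
    then have "norm z powr ?\<alpha> \<le> ((e / (C + 1)) powr (1 / ?\<alpha>)) powr ?\<alpha>"
      using \<alpha> by (intro powr_mono2) auto
    also have "\<dots> = e / (C + 1)" using \<alpha> e C by (simp add: powr_powr)
    finally have "C * norm z powr ?\<alpha> \<le> C * (e / (C + 1))" using C by (intro mult_left_mono)
    also have "\<dots> \<le> e" using e C by (simp add: field_simps)
    finally show ?thesis using C(2)[of "x - z" x] by simp
  qed
  define \<beta> where "\<beta> = (\<lambda>t. bump_poly 1 0 (t / r))"
  have \<beta>: "\<beta> \<in> bump_class r" unfolding \<beta>_def bump_class_def by blast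
  have \<beta>0: "0 \<le> \<beta> t" for t by (simp add: \<beta>_def bump_poly_def)
  define \<rho> where "\<rho> z = (\<Prod>i\<in>Basis. \<beta> (z \<bullet> i))" for z :: 'a
  have \<rho>0: "0 \<le> \<rho> z" for z by (simp add: \<rho>_def prod_nonneg \<beta>0)
  have \<rho>c: "continuous_on UNIV \<rho>"
    unfolding \<rho>_def[abs_def]
    by (intro continuous_on_prod continuous_on_compose2[OF bump_class_continuous[OF \<beta>, of UNIV]] continuous_intros) auto
  have \<rho>s: "\<bar>z \<bullet> i\<bar> < r" if "\<rho> z \<noteq> 0" "i \<in> Basis" for z i
    using that bump_class_eq_0[OF \<beta> r, of "z \<bullet> i"] by (fastforce simp: \<rho>_def)
  define a b :: 'a where "a = - (r *\<^sub>R One)" and "b = r *\<^sub>R One"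
  have \<rho>supp: "\<rho> z = 0" if "z \<notin> cbox a b" for z
  proof (rule ccontr)
    assume "\<rho> z \<noteq> 0"
    then have "\<bar>z \<bullet> i\<bar> < r" if "i \<in> Basis" for i using \<rho>s that by blast
    then have "z \<in> cbox a b" by (force simp: mem_box a_def b_def)
    then show False using that by blast
  qed
  define c where "c = (\<integral>z. \<rho> z \<partial>lborel)"
  have \<rho>i: "integrable lborel \<rho>" using integrable_continuous_compact_support[OF \<rho>c \<rho>supp] .
  have "c \<noteq> 0"
  proof
    assume "c = 0"
    then have "AE z in lborel. \<rho> z = 0"
      using integral_nonneg_eq_0_iff_AE[OF \<rho>i] \<rho>0 by (simp add: c_def)
    then have "\<rho> 0 = 0" by (rule continuous_AE_eq_0[OF \<rho>c])
    then show False by (simp add: \<rho>_def \<beta>_def bump_poly_def)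
  qed
  moreover have "0 \<le> c" unfolding c_def using \<rho>0 by (intro Bochner_Integration.integral_nonneg) auto
  ultimately have c: "0 < c" by simp
  define k where "k z = \<rho> z / c" for z
  have kc: "continuous_on UNIV k" unfolding k_def[abs_def] using \<rho>c c by (intro continuous_intros) auto
  have k0: "0 \<le> k z" for z using \<rho>0 c by (simp add: k_def)
  have ksupp: "k z = 0" if "z \<notin> cbox a b" for z using \<rho>supp[OF that] by (simp add: k_def)
  have k1: "(\<integral>z. k z \<partial>lborel) = 1" using c by (simp add: k_def c_def[symmetric])
  have ki: "integrable lborel k" using \<rho>i by (simp add: k_def[abs_def])
  \<comment> \<open>The convolution is taken over the support of f rather than that of the kernel,
    so the box does not move with x.\<close>
  define a' b' :: 'a where "a' = - (\<bar>R\<bar> *\<^sub>R One)" and "b' = \<bar>R\<bar> *\<^sub>R One"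
  have fsupp: "f y = 0" if "y \<notin> cbox a' b'" for y
  proof (rule supp, rule ccontr)
    assume "\<not> R \<le> norm y"
    then have "\<bar>y \<bullet> i\<bar> \<le> \<bar>R\<bar>" if "i \<in> Basis" for i using Basis_le_norm[OF that, of y] by simp
    then have "y \<in> cbox a' b'" by (force simp: mem_box a'_def b'_def abs_le_iff)
    then show False using that by blast
  qed
  \<comment> \<open>The normalising constant is put on f, which leaves the bump profiles
    unscaled.\<close>
  define f' where "f' y = f y / c" for y
  have f'c: "continuous_on UNIV f'" unfolding f'_def[abs_def] using cont c by (intro continuous_intros) auto
  define g where "g = bump_conv a' b' f' (\<lambda>_. \<beta>)"
  have cf: "continuous_on UNIV (\<lambda>z. f (x - z))" for x
    by (rule continuous_on_compose2[OF cont]) (auto intro!: continuous_intros)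
  have ck: "continuous_on UNIV (\<lambda>z. k (x - z))" for x
    by (rule continuous_on_compose2[OF kc]) (auto intro!: continuous_intros)
  have g_eq: "g x = (\<integral>z. k z * f (x - z) \<partial>lborel)" for x
  proof -
    have "g x = integral (cbox a' b') (\<lambda>y. f y * k (x - y))"
      by (simp add: g_def bump_conv_def f'_def k_def \<rho>_def)
    also have "\<dots> = (\<integral>y. f y * k (x - y) \<partial>lborel)"
      using fsupp by (intro lborel_integral_compact_support[symmetric] continuous_on_mult cont ck) auto
    also have "\<dots> = (\<integral>y. f (x - y) * k (x - (x - y)) \<partial>lborel)"
      by (rule integral_lborel_reflect[symmetric])
         (intro borel_measurable_continuous_onI continuous_on_mult cont ck)
    finally show ?thesis by (simp add: mult.commute)
  qed
  have "smooth_fun g" unfolding g_def using \<beta> by (intro smooth_fun_bump_conv[OF f'c, of _ r]) auto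
  moreover have "compact (closure {x. g x \<noteq> 0})"
  proof -
    have "norm x \<le> \<bar>R\<bar> + real DIM('a) * r" if "g x \<noteq> 0" for x
    proof -
      have "\<exists>z. k z * f (x - z) \<noteq> 0" 
      proof (rule ccontr)
        assume "\<nexists>z. k z * f (x - z) \<noteq> 0"
        then have "(\<lambda>z. k z * f (x - z)) = (\<lambda>z. 0)" by blast
        then show False using that unfolding g_eq by simp
      qed
      then obtain z where z: "k z \<noteq> 0" "f (x - z) \<noteq> 0" by auto
      have "norm z \<le> (\<Sum>i\<in>Basis. \<bar>z \<bullet> i\<bar>)" by (rule norm_le_l1)
      also have "\<dots> \<le> (\<Sum>i\<in>(Basis::'a set). r)"
        using z(1) by (intro sum_mono less_imp_le \<rho>s) (auto simp: k_def)
      finally have "norm z \<le> real DIM('a) * r" by simp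
      moreover have "norm (x - z) \<le> \<bar>R\<bar>" using supp[of "x - z"] z(2) by force
      ultimately show ?thesis using norm_triangle_ineq[of "x - z" z] by simp
    qed
    then have "bounded {x. g x \<noteq> 0}" by (auto simp: bounded_iff)
    then show ?thesis by (simp add: compact_closure)
  qed
  ultimately have "test_fun g" by (simp add: test_fun_def)
  moreover have "\<bar>g x - f x\<bar> \<le> e" for x
  proof -
    have i1: "integrable lborel (\<lambda>z. k z * f (x - z))"
      by (rule integrable_continuous_compact_support[of _ a b])
         (use ksupp in \<open>auto intro!: continuous_on_mult kc cf\<close>)
    have i2: "integrable lborel (\<lambda>z. k z * f x)" using ki by simp
    have "g x - f x = (\<integral>z. k z * f (x - z) \<partial>lborel) - (\<integral>z. k z * f x \<partial>lborel)"
      using k1 by (simp add: g_eq)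
    also have "\<dots> = (\<integral>z. k z * f (x - z) - k z * f x \<partial>lborel)"
      using i1 i2 by (rule Bochner_Integration.integral_diff[symmetric])
    finally have "\<bar>g x - f x\<bar> \<le> (\<integral>z. \<bar>k z * f (x - z) - k z * f x\<bar> \<partial>lborel)"
      by (metis integral_abs_bound)
    also have "\<dots> \<le> (\<integral>z. k z * e \<partial>lborel)"
    proof (rule integral_mono)
      fix z
      show "\<bar>k z * f (x - z) - k z * f x\<bar> \<le> k z * e"
      proof (cases "k z = 0")
        case False
        then have "\<bar>f (x - z) - f x\<bar> \<le> e" by (intro small \<rho>s) (auto simp: k_def)
        then have "k z * \<bar>f (x - z) - f x\<bar> \<le> k z * e" using k0 by (intro mult_left_mono)
        then show ?thesis using k0[of z] by (simp add: abs_mult flip: right_diff_distrib)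
      qed simp
    qed (use i1 i2 ki in auto)
    finally show ?thesis using k1 by simp
  qed
  moreover have "gagliardo_enn s p g \<le> gagliardo_enn s p f"
    by (rule gagliardo_enn_convolution_le[OF sp(3) cont kc k0 ksupp k1 g_eq])
  ultimately show ?thesis by blast
qed

section \<open>The Morrey inequality and its extremals\<close>

lemma holder_sn_ge:
  fixes f :: "'a::euclidean_space \<Rightarrow> real"
  assumes "holder_bounded \<alpha> f" "x \<noteq> y"
  shows "\<bar>f x - f y\<bar> / norm (x - y) powr \<alpha> \<le> holder_sn \<alpha> f"
proof -
  obtain C where "\<And>x y. x \<noteq> y \<Longrightarrow> \<bar>f x - f y\<bar> / norm (x - y) powr \<alpha> \<le> C"
    using assms(1) unfolding holder_bounded_def by blast
  then have "bdd_above ((\<lambda>z. \<bar>f (fst z) - f (snd z)\<bar> / norm (fst z - snd z) powr \<alpha>) ` {z. fst z \<noteq> snd z})"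
    by (intro bdd_aboveI2[where M = C]) auto
  then show ?thesis
    unfolding holder_sn_def using cSUP_upper[of "(x, y)" "{z. fst z \<noteq> snd z}"] assms(2) by fastforce
qed

lemma holder_sn_le:
  fixes f :: "'a::euclidean_space \<Rightarrow> real"
  assumes "\<And>x y. x \<noteq> y \<Longrightarrow> \<bar>f x - f y\<bar> / norm (x - y) powr \<alpha> \<le> B"
  shows "holder_sn \<alpha> f \<le> B"
  unfolding holder_sn_def
proof (rule cSUP_least)
  obtain b :: 'a where "b \<in> Basis" using nonempty_Basis by blast
  then have "(b, 0) \<in> {z :: 'a \<times> 'a. fst z \<noteq> snd z}" by auto
  then show "{z :: 'a \<times> 'a. fst z \<noteq> snd z} \<noteq> {}" by blast
qed (use assms in auto)

lemma holder_sn_divide: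
  fixes f :: "'a::euclidean_space \<Rightarrow> real"
  assumes f: "holder_bounded \<alpha> f" and c: "0 < c"
  shows "holder_sn \<alpha> (\<lambda>x. f x / c) = holder_sn \<alpha> f / c"
proof (rule antisym)
  have eq: "\<bar>f x / c - f y / c\<bar> / n = (\<bar>f x - f y\<bar> / n) / c" for x y n
    using c by (simp add: diff_divide_distrib[symmetric] abs_divide)
  have le: "\<bar>f x / c - f y / c\<bar> / norm (x - y) powr \<alpha> \<le> holder_sn \<alpha> f / c" if "x \<noteq> y" for x y
    unfolding eq using holder_sn_ge[OF f that] c by (intro divide_right_mono) auto
  then show "holder_sn \<alpha> (\<lambda>x. f x / c) \<le> holder_sn \<alpha> f / c" by (rule holder_sn_le)
  have hb: "holder_bounded \<alpha> (\<lambda>x. f x / c)" using le unfolding holder_bounded_def by blast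
  have "holder_sn \<alpha> f \<le> c * holder_sn \<alpha> (\<lambda>x. f x / c)"
  proof (rule holder_sn_le)
    fix x y :: 'a assume "x \<noteq> y"
    then have "(\<bar>f x - f y\<bar> / norm (x - y) powr \<alpha>) / c \<le> holder_sn \<alpha> (\<lambda>x. f x / c)"
      using holder_sn_ge[OF hb] unfolding eq by blast
    then show "\<bar>f x - f y\<bar> / norm (x - y) powr \<alpha> \<le> c * holder_sn \<alpha> (\<lambda>x. f x / c)"
      unfolding mult.commute[of c] by (rule pos_divide_le_eq[OF c, THEN iffD1])
  qed
  then show "holder_sn \<alpha> f / c \<le> holder_sn \<alpha> (\<lambda>x. f x / c)" using c by (simp add: pos_divide_le_eq mult.commute)
qed

lemma holder_sn_pos:
  assumes "holder_bounded \<alpha> f" "f x \<noteq> f y" shows "0 < holder_sn \<alpha> f"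
proof -
  have ne: "x \<noteq> y" using assms by auto
  have "0 < \<bar>f x - f y\<bar> / norm (x - y) powr \<alpha>" using assms ne by auto
  then show ?thesis using holder_sn_ge[OF assms(1) ne] by linarith
qed

lemma smooth_fun_divide:
  fixes f :: "'a::euclidean_space \<Rightarrow> real"
  assumes f: "smooth_fun f" shows "smooth_fun (\<lambda>x. f x / c)"
proof -
  have eq: "foldr partial_deriv vs (\<lambda>x. f x / c) = (\<lambda>x. foldr partial_deriv vs f x / c)"
    if "set vs \<subseteq> Basis" for vs
    using that
  proof (induction vs)
    case (Cons v vs)
    have "partial_deriv v (\<lambda>x. foldr partial_deriv vs f x / c) x = partial_deriv v (foldr partial_deriv vs f) x / c" for x
    proof -
      have "(\<lambda>t. foldr partial_deriv vs f (x + t *\<^sub>R v)) differentiable (at 0)"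
        using f Cons.prems unfolding smooth_fun_def by auto
      then have "((\<lambda>t. foldr partial_deriv vs f (x + t *\<^sub>R v)) has_real_derivative
          partial_deriv v (foldr partial_deriv vs f) x) (at 0)"
        unfolding partial_deriv_def by (simp add: DERIV_deriv_iff_real_differentiable)
      then show ?thesis
        unfolding partial_deriv_def[of v "\<lambda>x. foldr partial_deriv vs f x / c"]
        by (intro DERIV_imp_deriv DERIV_cdivide)
    qed
    then show ?case using Cons by auto
  qed simp
  show ?thesis
    unfolding smooth_fun_def
  proof (intro allI impI conjI ballI)
    fix vs assume vs: "set vs \<subseteq> (Basis :: 'a set)"
    have "continuous_on UNIV (foldr partial_deriv vs f)" using f vs unfolding smooth_fun_def by blast
    then show "continuous_on UNIV (foldr partial_deriv vs (\<lambda>x. f x / c))"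
      unfolding eq[OF vs] unfolding divide_inverse by (intro continuous_on_mult continuous_on_const)
    fix v x assume "v \<in> (Basis :: 'a set)"
    then have "(\<lambda>t. foldr partial_deriv vs f (x + t *\<^sub>R v)) differentiable (at 0)"
      using f vs unfolding smooth_fun_def by blast
    then show "(\<lambda>t. foldr partial_deriv vs (\<lambda>x. f x / c) (x + t *\<^sub>R v)) differentiable (at 0)"
      unfolding eq[OF vs] unfolding divide_inverse by simp
  qed
qed

lemma test_fun_divide: "test_fun f \<Longrightarrow> c \<noteq> 0 \<Longrightarrow> test_fun (\<lambda>x. f x / c)"
  by (simp add: test_fun_def smooth_fun_divide)

text \<open>A hat separates points. Mollified, it gives a nonconstant test function; as a test in
  the dipole equation, it rules out constant solutions.\<close>

lemma hat_in_Wsp: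
  fixes x0 :: "'a::euclidean_space"
  assumes "0 < s" "s < 1" "1 < p" "s * p > real DIM('a)"
  shows "(\<lambda>x. max 0 (r - norm (x - x0))) \<in> Wsp s p"
proof (rule lipschitz_compact_support_in_Wsp[OF assms, where L = 1 and R = "norm x0 + r"])
  fix x y :: 'a
  show "\<bar>max 0 (r - norm (x - x0)) - max 0 (r - norm (y - x0))\<bar> \<le> 1 * norm (x - y)"
    using norm_triangle_ineq3[of "x - x0" "y - x0"] by (auto simp: max_def)
next
  fix x :: 'a assume "norm x0 + r \<le> norm x"
  then show "max 0 (r - norm (x - x0)) = 0"
    using norm_triangle_ineq2[of x x0] by auto
qed

definition admissible_energies :: "real \<Rightarrow> real \<Rightarrow> 'a::euclidean_space itself \<Rightarrow> real set" where
  "admissible_energies s p _ = {gagliardo_p s p \<phi> | \<phi> :: 'a \<Rightarrow> real.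
      test_fun \<phi> \<and> holder_sn (alpha_sp s p DIM('a)) \<phi> = 1}"

lemma m_sp_eq_Inf: "m_sp s p TYPE('a::euclidean_space) = Inf (admissible_energies s p TYPE('a::euclidean_space))"
  by (simp add: m_sp_def admissible_energies_def)

context
  fixes s p :: real
  assumes sp: "0 < s" "s < 1" "1 < p" "s * p > real DIM('a::euclidean_space)"
begin

text \<open>The energy is homogeneous of degree p and the seminorm of degree one, so the quotient is
  the energy of g divided by its seminorm.\<close>

lemma normalized_in_admissible:
  fixes g :: "'a \<Rightarrow> real"
  assumes g: "test_fun g" "g x \<noteq> g y"
  shows "gagliardo_p s p g / holder_sn (alpha_sp s p DIM('a)) g powr p \<in> admissible_energies s p TYPE('a)"
proof -
  have W: "g \<in> Wsp s p" by (rule test_fun_in_Wsp[OF sp g(1)])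
  define c where "c = holder_sn (alpha_sp s p DIM('a)) g"
  have c: "0 < c" unfolding c_def by (rule holder_sn_pos[OF WspD(2)[OF W] g(2)])
  have "gagliardo_p s p (\<lambda>x. g x / c) = \<bar>1 / c\<bar> powr p * gagliardo_p s p g"
    using gagliardo_p_cmult[OF Wsp_measurable[OF W], of s p "1 / c" 0] by simp
  then have "gagliardo_p s p (\<lambda>x. g x / c) = gagliardo_p s p g / c powr p"
    using c by (simp add: powr_divide)
  moreover have "holder_sn (alpha_sp s p DIM('a)) (\<lambda>x. g x / c) = 1"
    using holder_sn_divide[OF WspD(2)[OF W] c] c by (simp add: c_def)
  moreover have "test_fun (\<lambda>x. g x / c)" using g(1) c by (intro test_fun_divide) auto
  ultimately show ?thesis unfolding admissible_energies_def c_def[symmetric] by (metis (mono_tags, lifting) mem_Collect_eq)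
qed

text \<open>The infimum of the empty set of reals carries no information, so lower bounds on
  \<open>m_sp\<close> have to be preceded by this.\<close>

lemma admissible_nonempty: "admissible_energies s p TYPE('a) \<noteq> {}"
proof -
  obtain b :: 'a where b: "b \<in> Basis" using nonempty_Basis by blast
  let ?h = "\<lambda>x::'a. max 0 (1 - norm (x - 0))"
  have h: "?h x = 0" if "1 \<le> norm x" for x using that by simp
  have "\<exists>g. test_fun g \<and> (\<forall>x. \<bar>g x - ?h x\<bar> \<le> 1 / 4) \<and> gagliardo_enn s p g \<le> gagliardo_enn s p ?h"
    by (rule mollify[OF sp hat_in_Wsp[OF sp] h]) simp_all
  then obtain g where g: "test_fun g" "\<And>x. \<bar>g x - ?h x\<bar> \<le> 1 / 4" by blast
  \<comment> \<open>The hat is 1 at 0 and 0 at b, and the tolerance 1/4 keeps these values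
    apart.\<close>
  have "g 0 \<noteq> g b" using g(2)[of 0] g(2)[of b] b by auto
  then show ?thesis using normalized_in_admissible[OF g(1)] by blast
qed

lemma m_sp_nonneg: "0 \<le> m_sp s p TYPE('a)"
  unfolding m_sp_eq_Inf by (rule cInf_greatest[OF admissible_nonempty]) (auto simp: admissible_energies_def)

lemma morrey_test_fun:
  fixes g :: "'a \<Rightarrow> real"
  assumes g: "test_fun g" "x \<noteq> y"
  shows "m_sp s p TYPE('a) * (\<bar>g x - g y\<bar> / norm (x - y) powr alpha_sp s p DIM('a)) powr p \<le> gagliardo_p s p g"
proof (cases "g x = g y")
  case False
  have W: "g \<in> Wsp s p" by (rule test_fun_in_Wsp[OF sp g(1)])
  have c: "0 < holder_sn (alpha_sp s p DIM('a)) g" by (rule holder_sn_pos[OF WspD(2)[OF W] False])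
  have "bdd_below (admissible_energies s p TYPE('a))" by (rule bdd_belowI[of _ 0]) (auto simp: admissible_energies_def)
  then have "m_sp s p TYPE('a) \<le> gagliardo_p s p g / holder_sn (alpha_sp s p DIM('a)) g powr p"
    unfolding m_sp_eq_Inf by (intro cInf_lower normalized_in_admissible[OF g(1) False])
  then have "m_sp s p TYPE('a) * holder_sn (alpha_sp s p DIM('a)) g powr p \<le> gagliardo_p s p g" using c by (simp add: pos_le_divide_eq)
  moreover have "(\<bar>g x - g y\<bar> / norm (x - y) powr alpha_sp s p DIM('a)) powr p \<le> holder_sn (alpha_sp s p DIM('a)) g powr p"
    using holder_sn_ge[OF WspD(2)[OF W] g(2)] sp by (intro powr_mono2) auto
  then have "m_sp s p TYPE('a) * (\<bar>g x - g y\<bar> / norm (x - y) powr alpha_sp s p DIM('a)) powr p \<le> m_sp s p TYPE('a) * holder_sn (alpha_sp s p DIM('a)) g powr p"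
    using m_sp_nonneg by (rule mult_left_mono)
  ultimately show ?thesis by linarith
qed simp

text \<open>The left side depends on two values only, so pointwise convergence of the mollifications
  suffices; on the right their energies are bounded by that of f.\<close>

lemma morrey_compact_support:
  fixes f :: "'a \<Rightarrow> real"
  assumes f: "f \<in> Wsp s p" "\<And>x. R \<le> norm x \<Longrightarrow> f x = 0" and xy: "x \<noteq> y"
  shows "m_sp s p TYPE('a) * (\<bar>f x - f y\<bar> / norm (x - y) powr alpha_sp s p DIM('a)) powr p \<le> gagliardo_p s p f"
proof -
  have "\<exists>g. test_fun g \<and> (\<forall>x. \<bar>g x - f x\<bar> \<le> inverse (real (Suc n))) \<and> gagliardo_enn s p g \<le> gagliardo_enn s p f" for n
    by (rule mollify[OF sp f]) auto
  then obtain g where g: "\<And>n. test_fun (g n)" "\<And>n x. \<bar>g n x - f x\<bar> \<le> inverse (real (Suc n))"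
    "\<And>n. gagliardo_enn s p (g n) \<le> gagliardo_enn s p f" by metis
  have lim: "(\<lambda>n. g n x) \<longlonglongrightarrow> f x" for x
  proof -
    have "(\<lambda>n. g n x - f x) \<longlonglongrightarrow> 0"
      by (rule Lim_null_comparison[OF _ LIMSEQ_inverse_real_of_nat]) (use g(2) in auto)
    then show ?thesis by (simp add: LIM_zero_iff)
  qed
  have "(\<lambda>n. m_sp s p TYPE('a) * (\<bar>g n x - g n y\<bar> / norm (x - y) powr alpha_sp s p DIM('a)) powr p) \<longlonglongrightarrow>
      m_sp s p TYPE('a) * (\<bar>f x - f y\<bar> / norm (x - y) powr alpha_sp s p DIM('a)) powr p"
    using sp xy by (intro tendsto_mult tendsto_const tendsto_powr' tendsto_divide tendsto_rabs tendsto_diff lim) auto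
  moreover have "m_sp s p TYPE('a) * (\<bar>g n x - g n y\<bar> / norm (x - y) powr alpha_sp s p DIM('a)) powr p \<le> gagliardo_p s p f" for n
  proof -
    have "gagliardo_p s p (g n) \<le> gagliardo_p s p f"
      unfolding gagliardo_p_def using g(3)[of n] WspD(3)[OF f(1)] by (intro enn2real_mono) auto
    then show ?thesis using morrey_test_fun[OF g(1) xy, of n] by linarith
  qed
  ultimately show ?thesis by (intro LIMSEQ_le_const2) auto
qed

text \<open>After truncating \<open>f\<close> to a bounded range \<open>[0, 2M]\<close> one may cut off with \<open>2M \<eta>(x/R)\<close>: the energy
  of the cut-off scales like \<open>R^(N - sp)\<close> and disappears as \<open>R \<rightarrow> \<infinity>\<close>.\<close>

lemma morrey:
  fixes f :: "'a \<Rightarrow> real"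
  assumes f: "f \<in> Wsp s p" and xy: "x \<noteq> y"
  shows "m_sp s p TYPE('a) * (\<bar>f x - f y\<bar> / norm (x - y) powr alpha_sp s p DIM('a)) powr p \<le> gagliardo_p s p f"
proof -
  \<comment> \<open>Both f x and f y lie in [-M, M], so truncation keeps their difference. The shift
    by M makes the function nonnegative, so that its minimum with a cut-off vanishes wherever the
    cut-off does.\<close>
  define M where "M = \<bar>f x\<bar> + \<bar>f y\<bar>"
  define h where "h z = max 0 (min (2 * M) (f z + M))" for z
  define \<eta> where "\<eta> z = min 1 (max 0 (2 - norm (z - 0)))" for z :: 'a
  define r where "r n = inverse (real (Suc n))" for n
  \<comment> \<open>Since 0 <= h <= 2 M, this minimum is h where the plateau function is one, and
    zero where it vanishes.\<close>
  define \<psi> where "\<psi> n z = min (h z) (2 * M * \<eta> (r n *\<^sub>R z))" for n z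
  have M: "0 \<le> M" by (simp add: M_def)
  have r: "0 < r n" for n by (simp add: r_def)
  have h0: "0 \<le> h z" "h z \<le> 2 * M" for z using M by (auto simp: h_def)
  have hxy: "h x = f x + M" "h y = f y + M" by (auto simp: h_def M_def)
  have hd: "\<bar>h z - h w\<bar> \<le> \<bar>f z - f w\<bar>" for z w by (auto simp: h_def)
  have \<eta>d: "\<bar>\<eta> z - \<eta> w\<bar> \<le> 1 * norm (z - w)" for z w
    using norm_triangle_ineq3[of z w] by (auto simp: \<eta>_def)
  have \<eta>W: "\<eta> \<in> Wsp s p"
    by (rule lipschitz_compact_support_in_Wsp[OF sp \<eta>d, of 2]) (auto simp: \<eta>_def)
  have \<eta>nW: "(\<lambda>z. \<eta> (r n *\<^sub>R z)) \<in> Wsp s p" for n by (rule Wsp_similarity[OF \<eta>W similarity_scale[OF r]])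
  have hc: "continuous_on UNIV h"
    unfolding h_def[abs_def] using WspD(1)[OF f] by (intro continuous_intros)
  have hW: "h \<in> Wsp s p"
  proof -
    obtain C where "0 \<le> C" "\<And>x y. \<bar>f x - f y\<bar> \<le> C * norm (x - y) powr alpha_sp s p DIM('a)"
      using holder_boundedE[OF WspD(2)[OF f]] by blast
    then have "holder_bounded (alpha_sp s p DIM('a)) h" by (intro holder_boundedI[of _ C]) (meson hd order_trans)
    moreover have "gagliardo_enn s p h < \<infinity>"
      using gagliardo_enn_mono[OF sp(3) hd] WspD(3)[OF f] by (rule order.strict_trans1)
    ultimately show ?thesis using hc by (simp add: Wsp_def)
  qed
  have \<psi>d: "\<bar>\<psi> n z - \<psi> n w\<bar> \<le> max \<bar>h z - h w\<bar> (2 * M * \<bar>\<eta> (r n *\<^sub>R z) - \<eta> (r n *\<^sub>R w)\<bar>)" for n z w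
  proof -
    have "\<bar>min a b - min c d\<bar> \<le> max \<bar>a - c\<bar> \<bar>b - d\<bar>" for a b c d :: real by auto
    note this[of "h z" "2 * M * \<eta> (r n *\<^sub>R z)" "h w" "2 * M * \<eta> (r n *\<^sub>R w)"]
    moreover have "\<bar>2 * M * \<eta> (r n *\<^sub>R z) - 2 * M * \<eta> (r n *\<^sub>R w)\<bar>
        = 2 * M * \<bar>\<eta> (r n *\<^sub>R z) - \<eta> (r n *\<^sub>R w)\<bar>"
      using M by (simp add: abs_mult flip: right_diff_distrib)
    ultimately show ?thesis by (simp only: \<psi>_def)
  qed
  have \<psi>E: "gagliardo_enn s p (\<psi> n) \<le> ennreal 1 * gagliardo_enn s p h
      + ennreal ((2 * M) powr p) * gagliardo_enn s p (\<lambda>z. \<eta> (r n *\<^sub>R z))" for n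
  proof (rule gagliardo_enn_le_add)
    fix z w
    have "\<bar>\<psi> n z - \<psi> n w\<bar> powr p \<le> max \<bar>h z - h w\<bar> (2 * M * \<bar>\<eta> (r n *\<^sub>R z) - \<eta> (r n *\<^sub>R w)\<bar>) powr p"
      using sp \<psi>d by (intro powr_mono2) auto
    also have "\<dots> \<le> \<bar>h z - h w\<bar> powr p + (2 * M * \<bar>\<eta> (r n *\<^sub>R z) - \<eta> (r n *\<^sub>R w)\<bar>) powr p"
      using M by (intro max_powr_le_sum) auto
    finally show "\<bar>\<psi> n z - \<psi> n w\<bar> powr p \<le> 1 * \<bar>h z - h w\<bar> powr p
        + (2 * M) powr p * \<bar>\<eta> (r n *\<^sub>R z) - \<eta> (r n *\<^sub>R w)\<bar> powr p"
      by (simp only: powr_mult mult_1_left)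
  qed (use Wsp_measurable[OF hW] Wsp_measurable[OF \<eta>nW] in auto)
  have \<psi>W: "\<psi> n \<in> Wsp s p" for n
  proof -
    obtain C where C: "0 \<le> C" "\<And>x y. \<bar>h x - h y\<bar> \<le> C * norm (x - y) powr alpha_sp s p DIM('a)"
      using holder_boundedE[OF WspD(2)[OF hW]] by blast
    obtain D where D: "0 \<le> D" "\<And>x y. \<bar>\<eta> (r n *\<^sub>R x) - \<eta> (r n *\<^sub>R y)\<bar> \<le> D * norm (x - y) powr alpha_sp s p DIM('a)"
      using holder_boundedE[OF WspD(2)[OF \<eta>nW]] by blast
    have "holder_bounded (alpha_sp s p DIM('a)) (\<psi> n)"
    proof (rule holder_boundedI)
      fix z w
      have "\<bar>\<psi> n z - \<psi> n w\<bar> \<le> \<bar>h z - h w\<bar> + 2 * M * \<bar>\<eta> (r n *\<^sub>R z) - \<eta> (r n *\<^sub>R w)\<bar>"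
        using \<psi>d[of n z w] M mult_nonneg_nonneg[of "2 * M" "\<bar>\<eta> (r n *\<^sub>R z) - \<eta> (r n *\<^sub>R w)\<bar>"] by linarith
      also have "\<dots> \<le> C * norm (z - w) powr alpha_sp s p DIM('a) + 2 * M * (D * norm (z - w) powr alpha_sp s p DIM('a))"
        using M by (intro add_mono mult_left_mono C D) auto
      finally show "\<bar>\<psi> n z - \<psi> n w\<bar> \<le> (C + 2 * M * D) * norm (z - w) powr alpha_sp s p DIM('a)"
        by (simp add: algebra_simps)
    qed
    moreover have "gagliardo_enn s p (\<psi> n) < \<infinity>"
      by (rule order.strict_trans1[OF \<psi>E])
         (use WspD(3)[OF hW] WspD(3)[OF \<eta>nW] in \<open>simp add: ennreal_mult_less_top\<close>)
    moreover have "continuous_on UNIV (\<psi> n)"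
      unfolding \<psi>_def[abs_def]
      by (intro continuous_on_min continuous_on_mult continuous_on_const hc WspD(1)[OF \<eta>nW])
    ultimately show ?thesis by (simp add: Wsp_def)
  qed
  have \<psi>supp: "\<psi> n z = 0" if "2 * real (Suc n) \<le> norm z" for n z
  proof -
    have "norm (r n *\<^sub>R z) \<ge> 2" using that by (simp add: r_def field_simps)
    then have "\<eta> (r n *\<^sub>R z) = 0" by (simp add: \<eta>_def)
    then show ?thesis using h0(1)[of z] by (simp add: \<psi>_def)
  qed
  have \<psi>p: "gagliardo_p s p (\<psi> n) \<le> gagliardo_p s p f
      + (2 * M) powr p * (r n powr (s * p - real DIM('a)) * gagliardo_p s p \<eta>)" for n
  proof -
    have "ennreal (gagliardo_p s p (\<psi> n)) \<le> ennreal 1 * ennreal (gagliardo_p s p h)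
      + ennreal ((2 * M) powr p) * ennreal (gagliardo_p s p (\<lambda>z. \<eta> (r n *\<^sub>R z)))"
      using \<psi>E[of n] by (simp add: gagliardo_enn_eq_ennreal \<psi>W hW \<eta>nW)
    also have "\<dots> = ennreal (gagliardo_p s p h + (2 * M) powr p * gagliardo_p s p (\<lambda>z. \<eta> (r n *\<^sub>R z)))"
      by (simp add: ennreal_mult)
    finally have "gagliardo_p s p (\<psi> n) \<le> gagliardo_p s p h + (2 * M) powr p * gagliardo_p s p (\<lambda>z. \<eta> (r n *\<^sub>R z))"
      by (subst (asm) ennreal_le_iff) auto
    moreover have "gagliardo_p s p h \<le> gagliardo_p s p f"
      unfolding gagliardo_p_def using gagliardo_enn_mono[OF sp(3) hd] WspD(3)[OF f] by (intro enn2real_mono) auto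
    ultimately show ?thesis by (simp add: gagliardo_p_similarity[OF \<eta>W similarity_scale[OF r]])
  qed
  have \<psi>xy: "\<psi> n z = h z" if "norm z \<le> real (Suc n)" for n z
  proof -
    have "norm (r n *\<^sub>R z) \<le> 1" using that by (simp add: r_def field_simps)
    then have "\<eta> (r n *\<^sub>R z) = 1" by (simp add: \<eta>_def)
    then show ?thesis using h0(2)[of z] by (simp add: \<psi>_def)
  qed
  \<comment> \<open>From n0 on, x and y both lie where the dilated plateau function equals
    one.\<close>
  obtain n0 where n0: "max (norm x) (norm y) \<le> real n0" using real_arch_simple by blast
  have le: "m_sp s p TYPE('a) * (\<bar>f x - f y\<bar> / norm (x - y) powr alpha_sp s p DIM('a)) powr p \<le> gagliardo_p s p f
      + (2 * M) powr p * (r n powr (s * p - real DIM('a)) * gagliardo_p s p \<eta>)" if "n0 \<le> n" for n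
  proof -
    have "\<psi> n x - \<psi> n y = f x - f y" using \<psi>xy[of x n] \<psi>xy[of y n] n0 that hxy by simp
    moreover have "m_sp s p TYPE('a) * (\<bar>\<psi> n x - \<psi> n y\<bar> / norm (x - y) powr alpha_sp s p DIM('a)) powr p
        \<le> gagliardo_p s p (\<psi> n)"
      by (rule morrey_compact_support[OF \<psi>W \<psi>supp xy])
    ultimately show ?thesis using \<psi>p[of n] by simp
  qed
  \<comment> \<open>The exponent is positive because s p > N, so the limit
    \<open>0 powr (s * p - real DIM('a))\<close> is 0.\<close>
  have "(\<lambda>n. r n powr (s * p - real DIM('a))) \<longlonglongrightarrow> 0 powr (s * p - real DIM('a))"
    using sp LIMSEQ_inverse_real_of_nat unfolding r_def[abs_def] by (intro tendsto_powr' tendsto_const) auto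
  then have "(\<lambda>n. gagliardo_p s p f + (2 * M) powr p * (r n powr (s * p - real DIM('a)) * gagliardo_p s p \<eta>))
      \<longlonglongrightarrow> gagliardo_p s p f + (2 * M) powr p * (0 * gagliardo_p s p \<eta>)"
    by (intro tendsto_intros) simp
  then show ?thesis using le by (intro LIMSEQ_le_const[where X = "\<lambda>n. gagliardo_p s p f
      + (2 * M) powr p * (r n powr (s * p - real DIM('a)) * gagliardo_p s p \<eta>)"]) auto
qed

text \<open>A two-point minimizer, transplanted by the similarity that maps \<open>(x0, y0)\<close> to \<open>(x, y)\<close>, is a competitor
  for any other pair of points, so its quotient bounds all quotients.\<close>

lemma minimizer_quotient_le:
  fixes u f :: "'a \<Rightarrow> real"
  assumes u: "u \<in> Wsp s p" "x0 \<noteq> y0" "u x0 \<noteq> u y0"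
    and min: "\<And>f. f \<in> Wsp s p \<Longrightarrow> f x0 = u x0 \<Longrightarrow> f y0 = u y0 \<Longrightarrow> gagliardo_p s p u \<le> gagliardo_p s p f"
    and f: "f \<in> Wsp s p" "x \<noteq> y"
  shows "gagliardo_p s p u * (\<bar>f x - f y\<bar> / norm (x - y) powr alpha_sp s p DIM('a)) powr p
      \<le> gagliardo_p s p f * (\<bar>u x0 - u y0\<bar> / norm (x0 - y0) powr alpha_sp s p DIM('a)) powr p"
proof (cases "f x = f y")
  case False
  define r where "r = norm (x - y) / norm (x0 - y0)"
  obtain S where S: "similarity r S" "S x0 = x" "S y0 = y"
    using similarity_exists[OF u(2) f(2)] unfolding r_def by blast
  \<comment> \<open>The affine change c t + d carries the values f x and f y to \<open>u x0\<close>
    and \<open>u y0\<close>.\<close>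
  define c where "c = (u x0 - u y0) / (f x - f y)"
  define d where "d = u y0 - c * f y"
  have fS: "(\<lambda>z. f (S z)) \<in> Wsp s p" by (rule Wsp_similarity[OF f(1) S(1)])
  have "gagliardo_p s p u \<le> gagliardo_p s p (\<lambda>z. c * f (S z) + d)"
  proof (rule min)
    show "(\<lambda>z. c * f (S z) + d) \<in> Wsp s p" by (rule Wsp_affine[OF sp(3) fS])
    show "c * f (S y0) + d = u y0" by (simp add: d_def S)
    have "c * (f x - f y) = u x0 - u y0" using False by (simp add: c_def)
    then show "c * f (S x0) + d = u x0" by (simp add: d_def S algebra_simps)
  qed
  also have "\<dots> = \<bar>c\<bar> powr p * (r powr (s * p - real DIM('a)) * gagliardo_p s p f)"
    by (simp add: gagliardo_p_cmult[OF Wsp_measurable[OF fS]] gagliardo_p_similarity[OF f(1) S(1)])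
  finally have le: "gagliardo_p s p u \<le> \<bar>c\<bar> powr p * (r powr (s * p - real DIM('a)) * gagliardo_p s p f)" .
  \<comment> \<open>This identity turns the scaling factor of the energy into the quotient of the
    two Hoelder weights.\<close>
  have "s * p - real DIM('a) = alpha_sp s p DIM('a) * p" using sp by (simp add: alpha_sp_def field_simps)
  then have rp: "r powr (s * p - real DIM('a)) = norm (x - y) powr (alpha_sp s p DIM('a) * p) / norm (x0 - y0) powr (alpha_sp s p DIM('a) * p)"
    by (simp add: r_def powr_divide)
  have cp: "\<bar>c\<bar> powr p = \<bar>u x0 - u y0\<bar> powr p / \<bar>f x - f y\<bar> powr p"
    by (simp add: c_def abs_divide powr_divide)
  have pos: "0 < \<bar>f x - f y\<bar> powr p" "0 < norm (x - y) powr (alpha_sp s p DIM('a) * p)" "0 < norm (x0 - y0) powr (alpha_sp s p DIM('a) * p)"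
    using False f(2) u(2) by auto
  show ?thesis
    using le pos unfolding rp cp by (simp add: powr_divide powr_powr field_simps)
qed (simp add: mult_nonneg_nonneg)

text \<open>Comparing u with itself at other pairs identifies its seminorm. Comparing it with
  admissible test functions bounds \<open>m_sp\<close> from below, and the Morrey inequality for u
  at (x0, y0) gives the opposite bound.\<close>

lemma extremal_of_minimizer:
  fixes u :: "'a \<Rightarrow> real"
  assumes u: "u \<in> Wsp s p" "x0 \<noteq> y0" "u x0 \<noteq> u y0"
    and min: "\<And>f. f \<in> Wsp s p \<Longrightarrow> f x0 = u x0 \<Longrightarrow> f y0 = u y0 \<Longrightarrow> gagliardo_p s p u \<le> gagliardo_p s p f"
  shows "extremal s p u" "holder_sn (alpha_sp s p DIM('a)) u = \<bar>u x0 - u y0\<bar> / norm (x0 - y0) powr alpha_sp s p DIM('a)"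
proof -
  define H where "H = \<bar>u x0 - u y0\<bar> / norm (x0 - y0) powr alpha_sp s p DIM('a)"
  have H: "0 < H" using u by (simp add: H_def)
  have "gagliardo_p s p u \<noteq> 0" using gagliardo_p_eq_0_imp_const[OF sp(3) u(1)] u(3) by blast
  then have E: "0 < gagliardo_p s p u" using gagliardo_p_nonneg[of s p u] by linarith
  \<comment> \<open>With f = u the same positive energy stands on both sides of the comparison and
    cancels.\<close>
  have "\<bar>u x - u y\<bar> / norm (x - y) powr alpha_sp s p DIM('a) \<le> H" if "x \<noteq> y" for x y
  proof (rule ccontr)
    assume "\<not> \<bar>u x - u y\<bar> / norm (x - y) powr alpha_sp s p DIM('a) \<le> H"
    then have "H powr p < (\<bar>u x - u y\<bar> / norm (x - y) powr alpha_sp s p DIM('a)) powr p"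
      using H sp by (intro powr_less_mono2) auto
    then have "gagliardo_p s p u * H powr p
        < gagliardo_p s p u * (\<bar>u x - u y\<bar> / norm (x - y) powr alpha_sp s p DIM('a)) powr p"
      using E by (rule mult_strict_left_mono)
    then show False
      using minimizer_quotient_le[OF u min u(1) that] unfolding H_def by linarith
  qed
  then have "holder_sn (alpha_sp s p DIM('a)) u \<le> H" by (rule holder_sn_le)
  moreover have "H \<le> holder_sn (alpha_sp s p DIM('a)) u"
    unfolding H_def by (rule holder_sn_ge[OF WspD(2)[OF u(1)] u(2)])
  ultimately show hs: "holder_sn (alpha_sp s p DIM('a)) u = \<bar>u x0 - u y0\<bar> / norm (x0 - y0) powr alpha_sp s p DIM('a)" by (simp add: H_def)
  have "gagliardo_p s p u / H powr p \<le> m_sp s p TYPE('a)"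
    unfolding m_sp_eq_Inf
  proof (rule cInf_greatest[OF admissible_nonempty])
    fix t assume "t \<in> admissible_energies s p TYPE('a)"
    then obtain f :: "'a \<Rightarrow> real" where f: "test_fun f" "holder_sn (alpha_sp s p DIM('a)) f = 1" "t = gagliardo_p s p f"
      by (auto simp: admissible_energies_def)
    have W: "f \<in> Wsp s p" by (rule test_fun_in_Wsp[OF sp f(1)])
    \<comment> \<open>The seminorm of f is a supremum that may not be attained. The comparison is
      therefore solved for the quotient at each pair, which gives the uniform bound k, before
      passing to the supremum.\<close>
    define k where "k = (gagliardo_p s p f * H powr p / gagliardo_p s p u) powr (1 / p)"
    have "\<bar>f x - f y\<bar> / norm (x - y) powr alpha_sp s p DIM('a) \<le> k" if "x \<noteq> y" for x y
    proof -
      define X where "X = \<bar>f x - f y\<bar> / norm (x - y) powr alpha_sp s p DIM('a)"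
      have X: "0 \<le> X" by (simp add: X_def)
      have "gagliardo_p s p u * X powr p \<le> gagliardo_p s p f * H powr p"
        unfolding H_def X_def by (rule minimizer_quotient_le[OF u min W that])
      then have "X powr p \<le> gagliardo_p s p f * H powr p / gagliardo_p s p u"
        using E by (simp add: pos_le_divide_eq mult.commute)
      then have "(X powr p) powr (1 / p) \<le> k"
        unfolding k_def using sp(3) by (intro powr_mono2) auto
      then show ?thesis using sp(3) X unfolding X_def[symmetric] by (simp add: powr_powr)
    qed
    then have "1 \<le> k" using holder_sn_le[of f "alpha_sp s p DIM('a)" k] f(2) by simp
    then have "1 powr p \<le> k powr p" using sp by (intro powr_mono2) auto
    also have "k powr p = gagliardo_p s p f * H powr p / gagliardo_p s p u"
      using sp E by (simp add: k_def powr_powr)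
    finally show "gagliardo_p s p u / H powr p \<le> t"
      using E H f(3) by (simp add: field_simps)
  qed
  then have "gagliardo_p s p u \<le> m_sp s p TYPE('a) * H powr p" using H by (simp add: pos_divide_le_eq)
  moreover have "m_sp s p TYPE('a) * H powr p \<le> gagliardo_p s p u" unfolding H_def by (rule morrey[OF u(1,2)])
  ultimately have "gagliardo_p s p u = m_sp s p TYPE('a) * holder_sn (alpha_sp s p DIM('a)) u powr p" using hs by (simp add: H_def)
  then show "extremal s p u" unfolding extremal_def using u by blast
qed

text \<open>A competitor has the same quotient at (x0, y0) as u, which there equals the full
  seminorm of u; so the Morrey inequality at this single pair already bounds its energy below by
  that of u.\<close>

lemma extremal_imp_minimizer:
  fixes u :: "'a \<Rightarrow> real"
  assumes ext: "extremal s p u" and hs: "holder_sn (alpha_sp s p DIM('a)) u = \<bar>u x0 - u y0\<bar> / norm (x0 - y0) powr alpha_sp s p DIM('a)"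
    and "x0 \<noteq> y0"
  shows "u x0 \<noteq> u y0"
    and "f \<in> Wsp s p \<Longrightarrow> f x0 = u x0 \<Longrightarrow> f y0 = u y0 \<Longrightarrow> gagliardo_p s p u \<le> gagliardo_p s p f"
proof -
  obtain x y where u: "u \<in> Wsp s p" "u x \<noteq> u y"
    and E: "gagliardo_p s p u = m_sp s p TYPE('a) * holder_sn (alpha_sp s p DIM('a)) u powr p"
    using ext unfolding extremal_def by blast
  show "u x0 \<noteq> u y0" using holder_sn_pos[OF WspD(2)[OF u(1)] u(2)] hs by auto
  assume "f \<in> Wsp s p" "f x0 = u x0" "f y0 = u y0"
  then show "gagliardo_p s p u \<le> gagliardo_p s p f"
    using morrey[of f x0 y0] assms(3) by (simp add: E hs)
qed

text \<open>A constant pairs to zero with everything, whereas the hat centred at x0 that vanishes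
  first at y0 makes the right side nonzero.\<close>

lemma dipole_solution_nonconstant:
  fixes u :: "'a \<Rightarrow> real"
  assumes "weak_dipole_solution s p u c x0 y0" "c \<noteq> 0" "x0 \<noteq> y0"
  shows "\<exists>x y. u x \<noteq> u y"
proof (rule ccontr)
  assume "\<nexists>x y. u x \<noteq> u y"
  then have const: "u x = u y" for x y by blast
  have "dens_deriv s p u f = (\<lambda>z. 0)" for f
    by (rule ext) (simp add: dens_deriv_def Jp_def const[of "fst _" "snd _"])
  then have 0: "gpair s p u f = 0" for f by (simp add: gpair_def)
  let ?f = "\<lambda>x. max 0 (norm (y0 - x0) - norm (x - x0))"
  have "gpair s p u ?f = c * (?f x0 - ?f y0)"
    using assms(1) hat_in_Wsp[OF sp, of "norm (y0 - x0)" x0] unfolding weak_dipole_solution_gpair by blast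
  then show False using 0[of ?f] assms(2,3) by simp
qed

end

theorem theorem7p4:
  fixes s p :: real and x0 y0 :: "'a::euclidean_space" and u :: "'a \<Rightarrow> real"
  assumes "0 < s" "s < 1" "1 < p" "s * p > real DIM('a)" "x0 \<noteq> y0"
  shows "((extremal s p u \<and>
           holder_sn (alpha_sp s p DIM('a)) u
             = \<bar>u x0 - u y0\<bar> / norm (x0 - y0) powr alpha_sp s p DIM('a))
          \<longleftrightarrow> (u \<in> Wsp s p \<and> (\<exists>c. c \<noteq> 0 \<and> weak_dipole_solution s p u c x0 y0)))
       \<and> ((u \<in> Wsp s p \<and> (\<exists>c. c \<noteq> 0 \<and> weak_dipole_solution s p u c x0 y0))
          \<longleftrightarrow> (u \<in> Wsp s p \<and> (\<exists>x y. u x \<noteq> u y) \<and>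
               (\<forall>\<phi>\<in>Wsp s p. \<phi> x0 = u x0 \<and> \<phi> y0 = u y0 \<longrightarrow>
                  gagliardo_p s p u \<le> gagliardo_p s p \<phi> \<and>
                  (gagliardo_p s p \<phi> = gagliardo_p s p u \<longrightarrow> \<phi> = u))))"
    (is "(?i \<longleftrightarrow> ?ii) \<and> (?ii \<longleftrightarrow> ?iii)")
proof -
  note sp = assms(1-4)
  have i_ii: "?ii" if i: "?i"
  proof -
    have u: "u \<in> Wsp s p" using i by (simp add: extremal_def)
    note min = extremal_imp_minimizer[OF sp conjunct1[OF i] conjunct2[OF i] assms(5)]
    show ?thesis by (intro conjI u weak_dipole_solution_of_minimizer[OF assms(3) u min(1)] min(2))
  qed
  have ii_iii: "?iii" if ii: "?ii"
  proof -
    obtain c where u: "u \<in> Wsp s p" and c: "c \<noteq> 0" "weak_dipole_solution s p u c x0 y0" using ii by blast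
    show ?thesis
    proof (intro conjI ballI impI)
      show "u \<in> Wsp s p" by (rule u)
      show "\<exists>x y. u x \<noteq> u y" by (rule dipole_solution_nonconstant[OF sp c(2,1) assms(5)])
      fix f assume f: "f \<in> Wsp s p" "f x0 = u x0 \<and> f y0 = u y0"
      note min = weak_dipole_solution_imp_unique_minimizer[OF assms(3) u c(2) f(1) conjunct1[OF f(2)] conjunct2[OF f(2)]]
      show "gagliardo_p s p u \<le> gagliardo_p s p f" by (rule min(1))
      assume "gagliardo_p s p f = gagliardo_p s p u"
      then show "f = u" by (rule min(2))
    qed
  qed
  have iii_i: "?ii \<and> ?i" if iii: "?iii"
  proof -
    have u: "u \<in> Wsp s p" and nc: "\<exists>x y. u x \<noteq> u y" using iii by simp_all
    have min: "gagliardo_p s p u \<le> gagliardo_p s p f" if "f \<in> Wsp s p" "f x0 = u x0" "f y0 = u y0" for f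
      using iii that by simp
    \<comment> \<open>With equal prescribed values a constant function would be a competitor of zero
      energy, and then u itself would be constant.\<close>
    have ne: "u x0 \<noteq> u y0"
    proof
      assume eq: "u x0 = u y0"
      have "gagliardo_p s p u \<le> gagliardo_p s p (\<lambda>_::'a. u x0)"
        by (rule min) (simp_all add: eq Wsp_const[OF assms(3)])
      also have "\<dots> = 0" by (rule gagliardo_p_const[OF assms(3)])
      finally have "gagliardo_p s p u = 0" using gagliardo_p_nonneg[of s p u] by linarith
      then show False using gagliardo_p_eq_0_imp_const[OF assms(3) u] nc by blast
    qed
    show ?thesis
      by (intro conjI u weak_dipole_solution_of_minimizer[OF assms(3) u ne min]
          extremal_of_minimizer[OF sp u assms(5) ne min])
  qed
  have "(A \<Longrightarrow> B) \<Longrightarrow> (B \<Longrightarrow> C) \<Longrightarrow> (C \<Longrightarrow> B \<and> A) \<Longrightarrow> (A \<longleftrightarrow> B) \<and> (B \<longleftrightarrow> C)" for A B C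
    by blast
  from this[OF i_ii ii_iii iii_i] show ?thesis .
qed

end
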